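(* Let $(t_n)_{n\in\mathbb N}$ be positive numbers with $1=t_1>t_2>t_3>\dots$, $\lim_{n\to\infty}t_n=0$ and $\lim_{n\to\infty}t_{n+1}/t_n=0$, and let $(\zeta_n)_{n\in\mathbb N}$ be points of $\overline{\mathbb C_+}$ with $\lim_{n\to\infty}\chi(\zeta_{n+1},\zeta_n)=0$. Define the Hamiltonian $H\in\mathbb H$ by $H(t)=\Theta(\zeta_n)$ for $t\in(t_{n+1},t_n]$, $n\in\mathbb N$, and $H(t)=\Theta(0)$ for $t\in(1,\infty)$. Then for every $M\subseteq\mathbb C_+$ satisfying ( * ), $$\operatorname{Ca}(q_H)=\operatorname{CL}(q_H,M)=\operatorname{Cl}(\zeta_n),$$ where $\operatorname{Cl}(\zeta_n)=\{\zeta\in\overline{\mathbb C_+}:\exists n_k\to\infty,\ \zeta_{n_k}\to\zeta\}$.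
   Context: $\overline{\mathbb C_+}=\mathbb C_+\cup\mathbb R\cup\{\infty\}$ in the Riemann sphere, with chordal metric $\chi(\zeta,\xi)=\frac{2|\zeta-\xi|}{\sqrt{1+|\zeta|^2}\sqrt{1+|\xi|^2}}$. $\mathbb H$ is the set of measurable $H:(0,\infty)\to\mathbb R^{2\times2}$ with $H(t)\ge0$, $\operatorname{tr}H(t)=1$ a.e. $\Theta(\zeta)$ denotes the constant matrix $\frac{1}{|\zeta|^2+1}\begin{pmatrix}|\zeta|^2&\operatorname{Re}\zeta\\\operatorname{Re}\zeta&1\end{pmatrix}$ for $\zeta\neq\infty$ and $\Theta(\infty)=\begin{pmatrix}1&0\\0&0\end{pmatrix}$. With $J=\begin{pmatrix}0&-1\\1&0\end{pmatrix}$ and $W(H;t,z)=(w_{ij})$ the solution of $\partial_tW(H;t,z)J=zW(H;t,z)H(t)$, $W(H;0,z)=I$, the Weyl coefficient is $q_H(z)=\lim_{t\to\infty}w_{12}(H;t,z)/w_{22}(H;t,z)$ (chordal limit), $z\in\mathbb C_+$. For $\alpha\in(0,\pi/2]$, $\Gamma_\alpha=\{z\in\mathbb C_+:\arg z\in[\alpha,\pi-\alpha]\}$. For $M\subseteq\mathbb C_+$, $\operatorname{CL}(q,M)=\{\zeta\in\overline{\mathbb C}:\exists z_n\in M,|z_n|\to\infty,q(z_n)\to\zeta\}$; $\operatorname{Ca}(q)=\bigcup_{\alpha\in(0,\pi/2]}\operatorname{CL}(q,\Gamma_\alpha)$. Condition ( * ) on $M\subseteq\mathbb C_+$: $M$ unbounded,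 $M\subseteq\Gamma_\alpha$ for some $\alpha\in(0,\pi/2]$, and $\{z\in M:|z|\ge r\}$ connected for all sufficiently large $r$. *)

theory Defs
  imports "HOL-Analysis.Analysis"
begin

text \<open>The Riemann sphere is modelled as \<open>complex option\<close>: \<open>Some w\<close> is the finite
  point w, \<open>None\<close> is the point at infinity.\<close>

type_synonym rsphere = "complex option"

definition chordal :: "rsphere \<Rightarrow> rsphere \<Rightarrow> real" where
  "chordal a b = (case (a, b) of
      (Some x, Some y) \<Rightarrow> 2 * cmod (x - y) / (sqrt (1 + (cmod x)\<^sup>2) * sqrt (1 + (cmod y)\<^sup>2))
    | (Some x, None) \<Rightarrow> 2 / sqrt (1 + (cmod x)\<^sup>2)
    | (None, Some y) \<Rightarrow> 2 / sqrt (1 + (cmod y)\<^sup>2)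
    | (None, None) \<Rightarrow> 0)"

definition closed_upper :: "rsphere set" where
  "closed_upper = {None} \<union> Some ` {w. Im w \<ge> 0}"

definition Theta :: "rsphere \<Rightarrow> real^2^2" where
  "Theta \<zeta> = (case \<zeta> of
      None \<Rightarrow> vector [vector [1, 0], vector [0, 0]]
    | Some w \<Rightarrow> (let c = 1 / ((cmod w)\<^sup>2 + 1) in
        vector [vector [c * (cmod w)\<^sup>2, c * Re w], vector [c * Re w, c]]))"

definition Jmat :: "complex^2^2" where
  "Jmat = vector [vector [0, -1], vector [1, 0]]"

definition cmat :: "real^2^2 \<Rightarrow> complex^2^2" where
  "cmat A = (\<chi> i j. complex_of_real (A $ i $ j))"

text \<open>W solves  d/dt W(t) J = z W(t) H(t), W(0) = I, i.e. (J^{-1} = -J) in integral form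
  W(t) = I + int_0^t z W(s) H(s) (-J) ds  for t \<ge> 0 (Caratheodory solution).
  For t < 0 the value is normalised to I to make the solution unique.\<close>
definition is_W :: "(real \<Rightarrow> real^2^2) \<Rightarrow> complex \<Rightarrow> (real \<Rightarrow> complex^2^2) \<Rightarrow> bool" where
  "is_W H z W \<longleftrightarrow>
     (\<forall>t<0. W t = mat 1) \<and>
     (\<forall>t\<ge>0. ((\<lambda>s. mat z ** W s ** cmat (H s) ** (- Jmat)) has_integral (W t - mat 1)) {0..t})"

definition Wsol :: "(real \<Rightarrow> real^2^2) \<Rightarrow> complex \<Rightarrow> real \<Rightarrow> complex^2^2" where
  "Wsol H z = (THE W. is_W H z W)"

definition rs_div :: "complex \<Rightarrow> complex \<Rightarrow> rsphere" where
  "rs_div a b = (if b = 0 then None else Some (a / b))"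

definition weyl_coeff :: "(real \<Rightarrow> real^2^2) \<Rightarrow> complex \<Rightarrow> rsphere" where
  "weyl_coeff H z = (THE \<zeta>. ((\<lambda>t. chordal (rs_div (Wsol H z t $ 1 $ 2) (Wsol H z t $ 2 $ 2)) \<zeta>)
                              \<longlongrightarrow> 0) at_top)"

definition Gamma_sector :: "real \<Rightarrow> complex set" where
  "Gamma_sector \<alpha> = {z. Im z > 0 \<and> \<alpha> \<le> Arg z \<and> Arg z \<le> pi - \<alpha>}"

definition cluster_set :: "(complex \<Rightarrow> rsphere) \<Rightarrow> complex set \<Rightarrow> rsphere set" where
  "cluster_set q M = {\<zeta>. \<exists>z::nat \<Rightarrow> complex. (\<forall>n. z n \<in> M) \<and>
       filterlim (\<lambda>n. cmod (z n)) at_top sequentially \<and>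
       (\<lambda>n. chordal (q (z n)) \<zeta>) \<longlonglongrightarrow> 0}"

definition Ca :: "(complex \<Rightarrow> rsphere) \<Rightarrow> rsphere set" where
  "Ca q = (\<Union>\<alpha>\<in>{0<..pi/2}. cluster_set q (Gamma_sector \<alpha>))"

definition cond_star :: "complex set \<Rightarrow> bool" where
  "cond_star M \<longleftrightarrow> M \<subseteq> {z. Im z > 0} \<and> \<not> bounded M \<and>
     (\<exists>\<alpha>\<in>{0<..pi/2}. M \<subseteq> Gamma_sector \<alpha>) \<and>
     (\<exists>r0. \<forall>r\<ge>r0. connected {z\<in>M. cmod z \<ge> r})"

definition seq_limit_points :: "(nat \<Rightarrow> rsphere) \<Rightarrow> rsphere set" where
  "seq_limit_points \<zeta>s = {\<zeta>\<in>closed_upper. \<exists>r::nat \<Rightarrow> nat. strict_mono r \<and>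
       (\<lambda>k. chordal (\<zeta>s (r k)) \<zeta>) \<longlonglongrightarrow> 0}"

end

theory Submission
  imports Defs
begin

text \<open>
  Because \<open>H\<close> equals \<open>\<Theta>(0)\<close> on \<open>(1, \<infinity>)\<close>, the Weyl coefficient is \<open>w\<^sub>1\<^sub>2(1) / w\<^sub>2\<^sub>2(1)\<close>. In
  homogeneous coordinates it is the limit at 0 of the solution \<open>y\<close> of \<open>y' = z H J y\<close> with
  \<open>y(1) = (0, 1)\<close>, continued from 1 down to 0 through the constant pieces. On a piece with value
  \<open>\<Theta>(\<zeta>)\<close> and length \<open>L\<close> the form \<open>Im (y\<^sub>1 cnj y\<^sub>2)\<close> stays nonnegative and grows at least by
  \<open>L Im z\<close> times the squared distance of the endpoint to \<open>\<zeta>\<close>; as the form is at most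
  \<open>|y|\<^sup>2 / 2\<close>, the chordal distance to \<open>\<zeta>\<close> at the left end of the piece is \<open>O((L Im z)\<^sup>-\<^sup>1\<^sup>/\<^sup>2)\<close>.
  If \<open>t\<^sub>n\<^sub>+\<^sub>1 < 1 / |z| \<le> t\<^sub>n\<close>, a piece whose length is large compared with \<open>1 / |z|\<close> therefore pulls \<open>y\<close>
  towards \<open>\<zeta>\<^sub>n\<^sub>-\<^sub>1\<close> or \<open>\<zeta>\<^sub>n\<close>, the one or two pieces of length comparable to \<open>1 / |z|\<close> that may follow
  distort the small distance only by a bounded factor, and the rest \<open>(0, t\<^sub>n\<^sub>+\<^sub>2]\<close> is too short to
  matter. Hence \<open>q\<^sub>H(z)\<close> is uniformly close to \<open>\<zeta>\<^sub>n\<close> in each sector, and an unbounded connected set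
  meets every large modulus.
\<close>

section \<open>Homogeneous coordinates on the sphere\<close>

text \<open>A point of the sphere is represented by the unit vector
  \<open>(hx \<zeta>, hy \<zeta>)\<close> of its complex line in C^2, with the phase fixed by a real
  nonnegative second coordinate.\<close>

definition hx :: "rsphere \<Rightarrow> complex" where
  "hx \<zeta> = (case \<zeta> of None \<Rightarrow> 1 | Some w \<Rightarrow> w / sqrt (1 + (cmod w)\<^sup>2))"

definition hy :: "rsphere \<Rightarrow> real" where
  "hy \<zeta> = (case \<zeta> of None \<Rightarrow> 0 | Some w \<Rightarrow> 1 / sqrt (1 + (cmod w)\<^sup>2))"

text \<open>The determinant of \<open>v\<close> against the unit vector over \<open>\<zeta>\<close>;
  its modulus is the distance of \<open>v\<close> from the line of \<open>\<zeta>\<close>.\<close>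

definition wedge :: "rsphere \<Rightarrow> complex \<times> complex \<Rightarrow> complex" where
  "wedge \<zeta> v = complex_of_real (hy \<zeta>) * fst v - hx \<zeta> * snd v"

lemma one_plus_square_pos: "0 < 1 + (x::real)\<^sup>2"
  by (simp add: add_pos_nonneg)

lemma hx_hy_unit: "(cmod (hx \<zeta>))\<^sup>2 + (hy \<zeta>)\<^sup>2 = 1"
proof (cases \<zeta>)
  case (Some w)
  show ?thesis
    using one_plus_square_pos[of "cmod w"]
    by (simp add: Some hx_def hy_def norm_divide power_divide field_simps)
qed (simp add: hx_def hy_def)

lemma hy_nonneg: "0 \<le> hy \<zeta>"
  by (simp add: hy_def split: option.split)

lemma Im_hx_nonneg: "\<zeta> \<in> closed_upper \<Longrightarrow> 0 \<le> Im (hx \<zeta>)"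
  by (auto simp: closed_upper_def hx_def)

lemma norm_hom: "norm (hx \<zeta>, complex_of_real (hy \<zeta>)) = 1"
  by (simp add: norm_Pair hx_hy_unit)

text \<open>\<open>Theta \<zeta>\<close> is the real part of the orthogonal projection onto the line
  of \<open>\<zeta>\<close>, which treats finite points and infinity by one formula.\<close>

lemma Theta_entries:
  "Theta \<zeta> $ 1 $ 1 = (cmod (hx \<zeta>))\<^sup>2" "Theta \<zeta> $ 1 $ 2 = hy \<zeta> * Re (hx \<zeta>)"
  "Theta \<zeta> $ 2 $ 1 = hy \<zeta> * Re (hx \<zeta>)" "Theta \<zeta> $ 2 $ 2 = (hy \<zeta>)\<^sup>2"
proof -
  have "Theta \<zeta> $ 1 $ 1 = (cmod (hx \<zeta>))\<^sup>2 \<and> Theta \<zeta> $ 1 $ 2 = hy \<zeta> * Re (hx \<zeta>) \<and>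
    Theta \<zeta> $ 2 $ 1 = hy \<zeta> * Re (hx \<zeta>) \<and> Theta \<zeta> $ 2 $ 2 = (hy \<zeta>)\<^sup>2"
  proof (cases \<zeta>)
    case (Some w)
    show ?thesis
      using one_plus_square_pos[of "cmod w"]
      by (simp add: Some hx_def hy_def Theta_def Let_def norm_divide power_divide add.commute)
  qed (simp add: hx_def hy_def Theta_def)
  then show "Theta \<zeta> $ 1 $ 1 = (cmod (hx \<zeta>))\<^sup>2" "Theta \<zeta> $ 1 $ 2 = hy \<zeta> * Re (hx \<zeta>)"
    "Theta \<zeta> $ 2 $ 1 = hy \<zeta> * Re (hx \<zeta>)" "Theta \<zeta> $ 2 $ 2 = (hy \<zeta>)\<^sup>2" by auto
qed

text \<open>The chordal metric is twice the sine of the angle between the two lines.\<close>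

lemma chordal_hom: "chordal \<xi> \<zeta> = 2 * cmod (wedge \<zeta> (hx \<xi>, complex_of_real (hy \<xi>)))"
proof -
  have "cmod (complex_of_real (1 / B) * (x / complex_of_real A) - y / complex_of_real B * complex_of_real (1 / A))
        = cmod (x - y) / (A * B)" if "A > 0" "B > 0" for A B :: real and x y
  proof -
    have "complex_of_real (1 / B) * (x / complex_of_real A) - y / complex_of_real B * complex_of_real (1 / A)
        = (x - y) / complex_of_real (A * B)" using that by (simp add: field_simps)
    then show ?thesis using that by (simp add: norm_divide norm_mult)
  qed
  note * = this
  show ?thesis
  proof (cases \<xi>; cases \<zeta>)
    fix x y assume [simp]: "\<xi> = Some x" "\<zeta> = Some y"
    have "sqrt (1 + (cmod x)\<^sup>2) > 0" "sqrt (1 + (cmod y)\<^sup>2) > 0"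
      using one_plus_square_pos by simp_all
    from *[OF this, of x y] show ?thesis
      by (simp add: chordal_def wedge_def hx_def hy_def)
  qed (auto simp: chordal_def wedge_def hx_def hy_def norm_divide)
qed

lemma wedge_linear:
  "wedge \<zeta> (u + v) = wedge \<zeta> u + wedge \<zeta> v" "wedge \<zeta> (u - v) = wedge \<zeta> u - wedge \<zeta> v"
  "wedge \<zeta> (c * a, c * b) = c * wedge \<zeta> (a, b)"
  by (simp_all add: wedge_def algebra_simps)

text \<open>\<open>(x, y)\<close> is the unit vector over \<open>rs_div x y\<close> times a scalar
  of modulus \<open>norm (x, y)\<close>, and \<open>wedge\<close> is homogeneous.\<close>

lemma chordal_rs_div:
  assumes "(x, y) \<noteq> (0, 0)"
  shows "chordal (rs_div x y) \<zeta> = 2 * cmod (wedge \<zeta> (x, y)) / norm (x, y)"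
proof -
  have "\<exists>c. cmod c = norm (x, y) \<and> x = c * hx (rs_div x y) \<and> y = c * hy (rs_div x y)"
  proof (cases "y = 0")
    case True
    then show ?thesis by (auto simp: rs_div_def hx_def hy_def norm_Pair)
  next
    case False
    let ?r = "sqrt (1 + (cmod (x / y))\<^sup>2)"
    have r: "?r > 0" using one_plus_square_pos by simp
    have "cmod y * ?r = sqrt ((cmod y)\<^sup>2 * (1 + (cmod (x / y))\<^sup>2))"
      by (simp add: real_sqrt_mult)
    also have "(cmod y)\<^sup>2 * (1 + (cmod (x / y))\<^sup>2) = (cmod x)\<^sup>2 + (cmod y)\<^sup>2"
      using False by (simp add: norm_divide field_simps)
    finally have "cmod (y * ?r) = norm (x, y)"
      using r by (simp add: norm_Pair norm_mult)
    moreover have "complex_of_real ?r \<noteq> 0" using r by (metis less_irrefl of_real_eq_0_iff)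
    ultimately show ?thesis
      using False by (intro exI[of _ "y * ?r"]) (simp add: rs_div_def hx_def hy_def)
  qed
  then obtain c where c: "cmod c = norm (x, y)" "x = c * hx (rs_div x y)" "y = c * hy (rs_div x y)"
    by blast
  have "wedge \<zeta> (x, y) = c * wedge \<zeta> (hx (rs_div x y), complex_of_real (hy (rs_div x y)))"
    by (metis c(2,3) wedge_linear(3))
  moreover have "norm (x, y) > 0" using assms by (simp add: zero_prod_def)
  ultimately show ?thesis
    by (simp add: chordal_hom norm_mult c(1))
qed

lemma cmod_pairing_le: "cmod (a * x + b * y) \<le> norm (a, b) * norm (x, y)"
proof -
  have "cmod (a * x + b * y) \<le> cmod a * cmod x + cmod b * cmod y"
    by (metis norm_mult norm_triangle_ineq)
  also have "\<dots> = inner (cmod a, cmod b) (cmod x, cmod y)" by simp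
  also have "\<dots> \<le> norm (cmod a, cmod b) * norm (cmod x, cmod y)"
    by (rule norm_cauchy_schwarz)
  finally show ?thesis by (simp add: norm_Pair)
qed

lemma cmod_wedge_le: "cmod (wedge \<zeta> v) \<le> norm v"
proof -
  have "wedge \<zeta> v = complex_of_real (hy \<zeta>) * fst v + (- hx \<zeta>) * snd v" by (simp add: wedge_def)
  then have "cmod (wedge \<zeta> v) \<le> norm (complex_of_real (hy \<zeta>), - hx \<zeta>) * norm (fst v, snd v)"
    using cmod_pairing_le by metis
  also have "norm (complex_of_real (hy \<zeta>), - hx \<zeta>) = 1"
    using norm_hom[of \<zeta>] by (simp add: norm_Pair add.commute)
  finally show ?thesis by simp
qed

text \<open>Expands v in the orthonormal basis given by the unit vector over \<open>\<xi>\<close> and its orthogonal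
  complement.\<close>
lemma wedge_triangle:
  "cmod (wedge \<zeta> v) \<le> cmod (wedge \<xi> v) + chordal \<xi> \<zeta> / 2 * norm v"
proof -
  let ?a = "hx \<xi>" and ?b = "complex_of_real (hy \<xi>)"
  have u: "?a * cnj ?a + ?b * ?b = 1"
    using hx_hy_unit[of \<xi>] by (metis complex_norm_square of_real_1 of_real_add of_real_mult power2_eq_square)
  have "wedge \<zeta> v = (cnj ?a * fst v + ?b * snd v) * wedge \<zeta> (?a, ?b)
      + wedge \<xi> v * wedge \<zeta> (?b, - cnj ?a)"
  proof -
    have "(cnj ?a * fst v + ?b * snd v) * wedge \<zeta> (?a, ?b)
      + wedge \<xi> v * wedge \<zeta> (?b, - cnj ?a) = (?a * cnj ?a + ?b * ?b) * wedge \<zeta> v"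
      by (simp add: wedge_def algebra_simps)
    then show ?thesis using u by simp
  qed
  also have "cmod \<dots> \<le> cmod (cnj ?a * fst v + ?b * snd v) * cmod (wedge \<zeta> (?a, ?b))
      + cmod (wedge \<xi> v) * cmod (wedge \<zeta> (?b, - cnj ?a))"
    by (metis norm_mult norm_triangle_ineq)
  also have "\<dots> \<le> norm v * (chordal \<xi> \<zeta> / 2) + cmod (wedge \<xi> v) * 1"
  proof (intro add_mono mult_mono)
    show "cmod (cnj ?a * fst v + ?b * snd v) \<le> norm v"
      using cmod_pairing_le[of "cnj ?a" "fst v" ?b "snd v"] norm_hom[of \<xi>]
      by (simp add: norm_Pair)
    show "cmod (wedge \<zeta> (?b, - cnj ?a)) \<le> 1"
      using cmod_wedge_le[of \<zeta> "(?b, - cnj ?a)"] norm_hom[of \<xi>]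
      by (simp add: norm_Pair add.commute)
  qed (auto simp: chordal_hom)
  finally show ?thesis by (simp add: mult.commute)
qed

lemma chordal_triangle: "chordal \<xi> \<zeta> \<le> chordal \<xi> \<omega> + chordal \<omega> \<zeta>"
  using wedge_triangle[of \<zeta> "(hx \<xi>, complex_of_real (hy \<xi>))" \<omega>] by (simp add: chordal_hom norm_hom)

lemma chordal_commute: "chordal \<xi> \<zeta> = chordal \<zeta> \<xi>"
  by (simp add: chordal_def norm_minus_commute mult.commute split: option.split)

lemma chordal_nonneg: "0 \<le> chordal \<xi> \<zeta>"
  by (simp add: chordal_hom)

lemma chordal_eq_0_iff: "chordal \<xi> \<zeta> = 0 \<longleftrightarrow> \<xi> = \<zeta>"
proof -
  have "sqrt (1 + (cmod x)\<^sup>2) \<noteq> 0" for x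
    using one_plus_square_pos[of "cmod x"] by simp
  then show ?thesis by (auto simp: chordal_def split: option.split)
qed

section \<open>The flow of a constant Hamiltonian\<close>

text \<open>Its square is the determinant of \<open>Theta \<zeta>\<close>; it vanishes exactly at
  real points and at infinity, where \<open>Theta \<zeta>\<close> has rank one.\<close>

definition eta :: "rsphere \<Rightarrow> real" where
  "eta \<zeta> = hy \<zeta> * Im (hx \<zeta>)"

text \<open>Extended continuously to \<eta> = 0, so that singular and regular pieces share one flow
  formula.\<close>

definition sn :: "real \<Rightarrow> complex \<Rightarrow> complex" where
  "sn \<eta> w = (if \<eta> = 0 then w else sin (complex_of_real \<eta> * w) / complex_of_real \<eta>)"

definition cs :: "real \<Rightarrow> complex \<Rightarrow> complex" where
  "cs \<eta> w = cos (complex_of_real \<eta> * w)"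

definition gen :: "rsphere \<Rightarrow> complex \<times> complex \<Rightarrow> complex \<times> complex" where
  "gen \<zeta> v = (- complex_of_real (hy \<zeta> * Re (hx \<zeta>)) * fst v + complex_of_real ((cmod (hx \<zeta>))\<^sup>2) * snd v,
             - complex_of_real ((hy \<zeta>)\<^sup>2) * fst v + complex_of_real (hy \<zeta> * Re (hx \<zeta>)) * snd v)"

text \<open>The matrix of \<open>gen \<zeta>\<close> is \<open>- \<Theta>(\<zeta>) J\<close>. Since it squares to \<open>- (eta \<zeta>)\<^sup>2\<close>, \<open>flow \<zeta> w\<close> is the
  exponential of \<open>w\<close> times it.\<close>
definition flow :: "rsphere \<Rightarrow> complex \<Rightarrow> complex \<times> complex \<Rightarrow> complex \<times> complex" where
  "flow \<zeta> w v = (cs (eta \<zeta>) w * fst v + sn (eta \<zeta>) w * fst (gen \<zeta> v),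
                cs (eta \<zeta>) w * snd v + sn (eta \<zeta>) w * snd (gen \<zeta> v))"

lemma cs_sn_simps [simp]: "cs \<eta> (- w) = cs \<eta> w" "sn \<eta> (- w) = - sn \<eta> w" "cs \<eta> 0 = 1" "sn \<eta> 0 = 0"
  by (simp_all add: cs_def sn_def)

lemma eta_sn: "complex_of_real \<eta> * sn \<eta> w = sin (complex_of_real \<eta> * w)"
  by (simp add: sn_def)

lemma cs_sn_square: "(cs \<eta> w)\<^sup>2 + (complex_of_real \<eta>)\<^sup>2 * (sn \<eta> w)\<^sup>2 = 1"
  unfolding power_mult_distrib[symmetric] eta_sn cs_def by simp

lemma cs_sn_exp: "cs \<eta> w + \<i> * complex_of_real \<eta> * sn \<eta> w = exp (\<i> * complex_of_real \<eta> * w)"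
  using eta_sn[of \<eta> w] exp_Euler[of "complex_of_real \<eta> * w"] by (simp add: cs_def mult.assoc)

lemma eta_square: "(cmod (hx \<zeta>))\<^sup>2 * (hy \<zeta>)\<^sup>2 - (hy \<zeta> * Re (hx \<zeta>))\<^sup>2 = (eta \<zeta>)\<^sup>2"
  by (simp add: eta_def cmod_power2 power_mult_distrib algebra_simps)

lemma abs_eta_le_1: "\<bar>eta \<zeta>\<bar> \<le> 1"
proof -
  have "(eta \<zeta>)\<^sup>2 \<le> (cmod (hx \<zeta>))\<^sup>2 * (hy \<zeta>)\<^sup>2" using eta_square[of \<zeta>] zero_le_power2 by (smt (verit))
  also have "\<dots> \<le> 1 * 1"
    using hx_hy_unit[of \<zeta>] zero_le_power2[of "hy \<zeta>"] zero_le_power2[of "cmod (hx \<zeta>)"]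
    by (intro mult_mono) linarith+
  finally show ?thesis by (simp add: abs_square_le_1)
qed

lemma eta_nonneg: "\<zeta> \<in> closed_upper \<Longrightarrow> 0 \<le> eta \<zeta>"
  by (simp add: eta_def hy_nonneg Im_hx_nonneg)

text \<open>The linear form \<open>wedge \<zeta>\<close> is a left eigenvector of the generator, so
  the flow only multiplies it by an exponential.\<close>

lemma wedge_gen: "wedge \<zeta> (gen \<zeta> v) = \<i> * complex_of_real (eta \<zeta>) * wedge \<zeta> v"
  unfolding gen_def cmod_power2
  by (auto simp: wedge_def eta_def complex_eq_iff power2_eq_square algebra_simps)

lemma wedge_flow: "wedge \<zeta> (flow \<zeta> w v) = exp (\<i> * complex_of_real (eta \<zeta>) * w) * wedge \<zeta> v"
proof -
  have "wedge \<zeta> (flow \<zeta> w v) = cs (eta \<zeta>) w * wedge \<zeta> v + sn (eta \<zeta>) w * wedge \<zeta> (gen \<zeta> v)"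
    by (simp add: wedge_def flow_def algebra_simps)
  also have "\<dots> = (cs (eta \<zeta>) w + \<i> * complex_of_real (eta \<zeta>) * sn (eta \<zeta>) w) * wedge \<zeta> v"
    by (simp add: wedge_gen algebra_simps)
  finally show ?thesis by (simp only: cs_sn_exp)
qed

text \<open>\<open>wedge\<close> taken at the conjugate point: a left eigenvector for the opposite
  eigenvalue.\<close>

definition cowedge :: "rsphere \<Rightarrow> complex \<times> complex \<Rightarrow> complex" where
  "cowedge \<zeta> v = complex_of_real (hy \<zeta>) * fst v - cnj (hx \<zeta>) * snd v"

lemma cowedge_gen: "cowedge \<zeta> (gen \<zeta> v) = - \<i> * complex_of_real (eta \<zeta>) * cowedge \<zeta> v"
  unfolding gen_def cmod_power2
  by (auto simp: cowedge_def eta_def complex_eq_iff power2_eq_square algebra_simps)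

lemma cowedge_flow: "cowedge \<zeta> (flow \<zeta> w v) = exp (- \<i> * complex_of_real (eta \<zeta>) * w) * cowedge \<zeta> v"
proof -
  have "cowedge \<zeta> (flow \<zeta> w v) = cs (eta \<zeta>) w * cowedge \<zeta> v + sn (eta \<zeta>) w * cowedge \<zeta> (gen \<zeta> v)"
    by (simp add: cowedge_def flow_def algebra_simps)
  \<comment> \<open>\<open>cs\<close> is even and \<open>sn\<close> is odd; passing to
    \<open>- w\<close> gives the shape of \<open>cs_sn_exp\<close>.\<close>
  also have "\<dots> = (cs (eta \<zeta>) (-w) + \<i> * complex_of_real (eta \<zeta>) * sn (eta \<zeta>) (-w)) * cowedge \<zeta> v"
    by (simp add: cowedge_gen algebra_simps)
  finally show ?thesis by (simp only: cs_sn_exp) simp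
qed

text \<open>Up to the factor \<open>(cmod (snd v))\<^sup>2\<close> this is the imaginary part of the
  quotient of the coordinates, so its sign tells on which side of the real line the point of
  \<open>v\<close> lies.\<close>

definition imform :: "complex \<times> complex \<Rightarrow> real" where
  "imform v = Im (fst v * cnj (snd v))"

text \<open>The two eigenforms diagonalise \<open>imform\<close>, so for nonzero
  \<open>eta \<zeta>\<close> its growth along the flow can be read off from the
  exponentials.\<close>

lemma cowedge_wedge_imform:
  "(cmod (cowedge \<zeta> v))\<^sup>2 - (cmod (wedge \<zeta> v))\<^sup>2 = 4 * eta \<zeta> * imform v"
  unfolding cmod_power2
  by (simp add: cowedge_def wedge_def imform_def eta_def power2_eq_square algebra_simps)

lemma imform_le: "imform v \<le> (norm v)\<^sup>2 / 2"
proof -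
  have "imform v \<le> cmod (fst v) * cmod (snd v)"
    unfolding imform_def by (metis abs_Im_le_cmod abs_le_D1 complex_mod_cnj norm_mult)
  also have "\<dots> \<le> ((cmod (fst v))\<^sup>2 + (cmod (snd v))\<^sup>2) / 2"
    using sum_squares_bound[of "cmod (fst v)" "cmod (snd v)"] by simp
  finally show ?thesis by (simp add: norm_prod_def)
qed

text \<open>Here the unit vector is real and \<open>Theta \<zeta>\<close> is the projection onto it,
  so the generator is nilpotent.\<close>

lemma gen_degenerate:
  assumes "eta \<zeta> = 0"
  shows "gen \<zeta> v = (- hx \<zeta> * wedge \<zeta> v, - complex_of_real (hy \<zeta>) * wedge \<zeta> v)"
proof (cases "hy \<zeta> = 0")
  case True
  then have "hx \<zeta> = 1" by (cases \<zeta>) (auto simp: hx_def hy_def add_nonneg_eq_0_iff)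
  then show ?thesis using True by (simp add: gen_def wedge_def)
next
  case False
  then have "Im (hx \<zeta>) = 0" using assms by (simp add: eta_def)
  then have "hx \<zeta> = complex_of_real (Re (hx \<zeta>))" by (simp add: complex_eq_iff)
  then obtain r where r: "hx \<zeta> = complex_of_real r" by blast
  show ?thesis by (simp add: gen_def wedge_def r power2_eq_square algebra_simps)
qed

text \<open>Quantitative form of the contraction of the Weyl discs.\<close>
lemma imform_flow_ge:
  assumes \<zeta>: "\<zeta> \<in> closed_upper" and w: "0 \<le> Im w" and v: "0 \<le> imform v"
  shows "Im w * (cmod (wedge \<zeta> (flow \<zeta> w v)))\<^sup>2 \<le> imform (flow \<zeta> w v)"
proof (cases "eta \<zeta> = 0")
  case True
  have hr: "Im (hx \<zeta>) = 0 \<or> hy \<zeta> = 0" using True by (auto simp: eta_def)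
  have "hy \<zeta> = 0 \<Longrightarrow> hx \<zeta> = 1" by (cases \<zeta>) (auto simp: hx_def hy_def add_nonneg_eq_0_iff)
  with hr have im0: "Im (hx \<zeta>) = 0" by auto
  define h where "h = wedge \<zeta> v"
  have u: "flow \<zeta> w v = (fst v - w * hx \<zeta> * h, snd v - w * complex_of_real (hy \<zeta>) * h)"
    by (simp add: flow_def True cs_def sn_def gen_degenerate h_def)
  have h: "h = complex_of_real (hy \<zeta>) * fst v - complex_of_real (Re (hx \<zeta>)) * snd v"
    using im0 by (simp add: h_def wedge_def complex_eq_iff)
  \<comment> \<open>With a nilpotent generator the flow is affine in \<open>w\<close>, and the
    growth of the form is exact.\<close>
  have "imform (flow \<zeta> w v) = imform v + Im (w * h * cnj h)"
    unfolding u imform_def using im0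
    by (simp add: h algebra_simps)
  moreover have "Im (w * h * cnj h) = Im w * (cmod h)\<^sup>2"
    by (metis Im_complex_of_real Re_complex_of_real add.right_neutral complex_norm_square mult.assoc mult.commute mult_zero_left times_complex.simps(2))
  moreover have "wedge \<zeta> (flow \<zeta> w v) = h" by (simp add: wedge_flow True h_def)
  ultimately show ?thesis using v by simp
next
  case False
  then have e: "eta \<zeta> > 0" using eta_nonneg[OF \<zeta>] by simp
  define m where "m = eta \<zeta> * Im w"
  have m: "m \<ge> 0" using e w by (simp add: m_def)
  define h k where "h = cmod (wedge \<zeta> v)" and "k = cmod (cowedge \<zeta> v)"
  let ?u = "flow \<zeta> w v"
  have hu: "cmod (wedge \<zeta> ?u) = exp (- m) * h"
    by (simp add: wedge_flow norm_mult h_def m_def)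
  have ku: "cmod (cowedge \<zeta> ?u) = exp m * k"
    by (simp add: cowedge_flow norm_mult k_def m_def)
  \<comment> \<open>A nonnegative form means that the expanding coordinate \<open>k\<close>
    dominates the contracting coordinate \<open>h\<close>.\<close>
  have "0 \<le> 4 * eta \<zeta> * imform v" using e v by simp
  then have hk: "h\<^sup>2 \<le> k\<^sup>2"
    using cowedge_wedge_imform[of \<zeta> v] unfolding h_def k_def by linarith
  have "4 * eta \<zeta> * imform ?u = (exp m)\<^sup>2 * k\<^sup>2 - (exp (- m))\<^sup>2 * h\<^sup>2"
    using cowedge_wedge_imform[of \<zeta> ?u] by (simp add: hu ku power_mult_distrib)
  also have "\<dots> \<ge> (exp m)\<^sup>2 * h\<^sup>2 - (exp (- m))\<^sup>2 * h\<^sup>2"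
    using hk by (simp add: mult_left_mono)
  also have "(exp m)\<^sup>2 * h\<^sup>2 - (exp (- m))\<^sup>2 * h\<^sup>2 = (exp (4 * m) - 1) * (exp (- m) * h)\<^sup>2"
  proof -
    have "exp (4 * m) * (exp (- m))\<^sup>2 = (exp m)\<^sup>2"
      by (simp add: exp_double[symmetric] exp_add[symmetric] flip: exp_of_nat_mult)
    then show ?thesis by (simp add: algebra_simps power_mult_distrib)
  qed
  \<comment> \<open>The linear lower bound leaves a factor \<open>eta \<zeta>\<close> on both sides;
    cancelling it makes the estimate uniform in \<open>\<zeta>\<close>.\<close>
  also have "\<dots> \<ge> (4 * m) * (exp (- m) * h)\<^sup>2"
    using exp_ge_add_one_self[of "4 * m"] by (intro mult_right_mono) (linarith, simp)
  finally have "4 * m * (cmod (wedge \<zeta> ?u))\<^sup>2 \<le> 4 * eta \<zeta> * imform ?u" by (simp add: hu)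
  then have "eta \<zeta> * (Im w * (cmod (wedge \<zeta> ?u))\<^sup>2) \<le> eta \<zeta> * imform ?u"
    by (simp add: m_def mult.assoc)
  then show ?thesis using e mult_le_cancel_left_pos by blast
qed

lemma wedge_flow_le:
  assumes "\<zeta> \<in> closed_upper" "0 \<le> Im w"
  shows "cmod (wedge \<zeta> (flow \<zeta> w v)) \<le> cmod (wedge \<zeta> v)"
proof -
  have "exp (- (eta \<zeta> * Im w)) \<le> 1" using assms eta_nonneg by simp
  then have "exp (- (eta \<zeta> * Im w)) * cmod (wedge \<zeta> v) \<le> 1 * cmod (wedge \<zeta> v)"
    by (intro mult_right_mono) auto
  then show ?thesis by (simp add: wedge_flow norm_mult)
qed

section \<open>Invertibility and norm bounds of the flow\<close>

lemma gen_gen: "gen \<zeta> (gen \<zeta> v) = (- (complex_of_real (eta \<zeta>))\<^sup>2 * fst v, - (complex_of_real (eta \<zeta>))\<^sup>2 * snd v)"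
  unfolding of_real_power[symmetric] eta_square[symmetric]
  by (simp add: gen_def power2_eq_square algebra_simps)

lemma flow_inverse: "flow \<zeta> (- w) (flow \<zeta> w v) = v"
proof -
  let ?c = "cs (eta \<zeta>) w" and ?s = "sn (eta \<zeta>) w" and ?e = "complex_of_real (eta \<zeta>)"
  have g: "gen \<zeta> (flow \<zeta> w v) = (?c * fst (gen \<zeta> v) + ?s * fst (gen \<zeta> (gen \<zeta> v)), ?c * snd (gen \<zeta> v) + ?s * snd (gen \<zeta> (gen \<zeta> v)))"
    by (simp add: gen_def flow_def algebra_simps)
  have "flow \<zeta> (- w) (flow \<zeta> w v) = ((?c\<^sup>2 + ?e\<^sup>2 * ?s\<^sup>2) * fst v, (?c\<^sup>2 + ?e\<^sup>2 * ?s\<^sup>2) * snd v)"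
    by (simp add: flow_def[of _ "- w"] g gen_gen) (simp add: flow_def power2_eq_square algebra_simps)
  then show ?thesis by (simp add: cs_sn_square)
qed

text \<open>The Hilbert-Schmidt norm of the generator is at most
  \<open>(cmod (hx \<zeta>))\<^sup>2 + (hy \<zeta>)\<^sup>2 = 1\<close>, because the determinant of
  \<open>Theta \<zeta>\<close> is nonnegative.\<close>

lemma norm_gen_le: "norm (gen \<zeta> v) \<le> norm v"
proof -
  let ?m = "hy \<zeta> * Re (hx \<zeta>)" and ?p = "(cmod (hx \<zeta>))\<^sup>2" and ?q = "(hy \<zeta>)\<^sup>2"
  have 1: "cmod (fst (gen \<zeta> v)) \<le> norm (- complex_of_real ?m, complex_of_real ?p) * norm v"
    using cmod_pairing_le[of "- complex_of_real ?m" "fst v" "complex_of_real ?p" "snd v"]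
    by (simp add: gen_def)
  have 2: "cmod (snd (gen \<zeta> v)) \<le> norm (- complex_of_real ?q, complex_of_real ?m) * norm v"
    using cmod_pairing_le[of "- complex_of_real ?q" "fst v" "complex_of_real ?m" "snd v"]
    by (simp add: gen_def)
  have "(norm (gen \<zeta> v))\<^sup>2 = (cmod (fst (gen \<zeta> v)))\<^sup>2 + (cmod (snd (gen \<zeta> v)))\<^sup>2"
    by (simp add: norm_prod_def)
  also have "\<dots> \<le> (norm (- complex_of_real ?m, complex_of_real ?p) * norm v)\<^sup>2
     + (norm (- complex_of_real ?q, complex_of_real ?m) * norm v)\<^sup>2"
    by (intro add_mono power_mono 1 2) auto
  also have "\<dots> = (2 * ?m\<^sup>2 + ?p\<^sup>2 + ?q\<^sup>2) * (norm v)\<^sup>2"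
    by (simp add: norm_Pair power_mult_distrib norm_mult norm_power abs_mult) (simp add: algebra_simps)
  also have "\<dots> \<le> 1 * (norm v)\<^sup>2"
  proof (intro mult_right_mono)
    have "?m\<^sup>2 \<le> ?p * ?q" using eta_square[of \<zeta>] zero_le_power2[of "eta \<zeta>"] by linarith
    then have "2 * ?m\<^sup>2 + ?p\<^sup>2 + ?q\<^sup>2 \<le> (?p + ?q)\<^sup>2" by (simp add: power2_sum)
    then show "2 * ?m\<^sup>2 + ?p\<^sup>2 + ?q\<^sup>2 \<le> 1" by (simp add: hx_hy_unit)
  qed auto
  finally show ?thesis by simp
qed

lemma cmod_exp_minus_1_le: "cmod (exp w - 1) \<le> cmod w * exp (cmod w)"
  using Taylor_exp_field[of w 0] by (simp add: mult.commute[of "cmod w"])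

lemma cs_minus_1_le:
  assumes "\<bar>\<eta>\<bar> \<le> 1" shows "cmod (cs \<eta> w - 1) \<le> cmod w * exp (cmod w)"
proof -
  let ?x = "complex_of_real \<eta> * w"
  have x: "cmod ?x \<le> cmod w" using assms by (simp add: norm_mult mult_left_le_one_le)
  have "cmod (cs \<eta> w - 1) = cmod ((exp (\<i> * ?x) - 1) + (exp (- (\<i> * ?x)) - 1)) / 2"
    using norm_divide[of "(exp (\<i> * ?x) - 1) + (exp (- (\<i> * ?x)) - 1)" 2]
    by (simp add: cs_def cos_exp_eq field_simps)
  also have "\<dots> \<le> (cmod (exp (\<i> * ?x) - 1) + cmod (exp (- (\<i> * ?x)) - 1)) / 2"
    by (intro divide_right_mono norm_triangle_ineq) simp
  also have "\<dots> \<le> cmod ?x * exp (cmod ?x)"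
    using cmod_exp_minus_1_le[of "\<i> * ?x"] cmod_exp_minus_1_le[of "- (\<i> * ?x)"] by (simp add: norm_mult)
  also have "\<dots> \<le> cmod w * exp (cmod w)" using x by (intro mult_mono) auto
  finally show ?thesis .
qed

lemma sn_le:
  assumes "\<bar>\<eta>\<bar> \<le> 1" shows "cmod (sn \<eta> w) \<le> cmod w * exp (cmod w)"
proof (cases "\<eta> = 0")
  case True
  then show ?thesis by (simp add: sn_def mult_le_cancel_left1)
next
  case False
  let ?x = "complex_of_real \<eta> * w"
  have x: "cmod ?x \<le> cmod w" using assms by (simp add: norm_mult mult_left_le_one_le)
  have "cmod (sin ?x) = cmod ((exp (\<i> * ?x) - 1) - (exp (- (\<i> * ?x)) - 1)) / 2"
    by (simp add: sin_exp_eq norm_divide norm_mult)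
  also have "\<dots> \<le> (cmod (exp (\<i> * ?x) - 1) + cmod (exp (- (\<i> * ?x)) - 1)) / 2"
    by (intro divide_right_mono norm_triangle_ineq4) simp
  also have "\<dots> \<le> cmod ?x * exp (cmod ?x)"
    using cmod_exp_minus_1_le[of "\<i> * ?x"] cmod_exp_minus_1_le[of "- (\<i> * ?x)"] by (simp add: norm_mult)
  also have "\<dots> \<le> cmod ?x * exp (cmod w)" using x by (intro mult_left_mono) auto
  finally have "cmod (sin ?x) / \<bar>\<eta>\<bar> \<le> cmod w * exp (cmod w)"
    using False by (simp add: divide_le_eq norm_mult mult_ac)
  then show ?thesis using False by (simp add: sn_def norm_divide)
qed

text \<open>Bounds of the shape exp(a) - 1 combine along consecutive pieces into one for the total
  length; the constant 3 absorbs the two summands of \<open>flow\<close>.\<close>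

lemma norm_flow_minus_le: "norm (flow \<zeta> w v - v) \<le> (exp (3 * cmod w) - 1) * norm v"
proof -
  let ?c = "cs (eta \<zeta>) w" and ?s = "sn (eta \<zeta>) w" and ?E = "cmod w * exp (cmod w)"
  have scale: "norm (c * x, c * y) = cmod c * norm (x, y)" for c x y :: complex
  proof -
    have "norm (c * x, c * y) = sqrt ((cmod c)\<^sup>2 * ((cmod x)\<^sup>2 + (cmod y)\<^sup>2))"
      by (simp add: norm_Pair norm_mult power_mult_distrib algebra_simps)
    then show ?thesis by (simp add: real_sqrt_mult norm_Pair)
  qed
  have "flow \<zeta> w v - v = ((?c - 1) * fst v, (?c - 1) * snd v) + (?s * fst (gen \<zeta> v), ?s * snd (gen \<zeta> v))"
    by (simp add: flow_def prod_eq_iff algebra_simps)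
  then have "norm (flow \<zeta> w v - v) \<le> cmod (?c - 1) * norm v + cmod ?s * norm (gen \<zeta> v)"
    by (metis (no_types) norm_triangle_ineq scale prod.collapse)
  also have "\<dots> \<le> ?E * norm v + ?E * norm v"
    by (intro add_mono mult_mono cs_minus_1_le sn_le abs_eta_le_1 norm_gen_le) auto
  also have "\<dots> = (2 * ?E) * norm v" by simp
  also have "\<dots> \<le> (exp (3 * cmod w) - 1) * norm v"
  proof (intro mult_right_mono)
    have "exp (3 * cmod w) = exp (cmod w) * exp (2 * cmod w)" by (simp flip: exp_add)
    also have "\<dots> \<ge> exp (cmod w) * (1 + 2 * cmod w)"
      by (intro mult_left_mono exp_ge_add_one_self) auto
    also have "exp (cmod w) * (1 + 2 * cmod w) = exp (cmod w) + 2 * ?E" by (simp add: algebra_simps)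
    finally show "2 * ?E \<le> exp (3 * cmod w) - 1"
      using exp_ge_add_one_self[of "cmod w"] norm_ge_zero[of w] by linarith
  qed auto
  finally show ?thesis .
qed

lemma norm_flow_le: "norm (flow \<zeta> w v) \<le> exp (3 * cmod w) * norm v"
  using norm_flow_minus_le[of \<zeta> w v] norm_triangle_ineq2[of "flow \<zeta> w v" v]
  by (simp add: algebra_simps)

lemma norm_flow_ge: "norm v \<le> exp (3 * cmod w) * norm (flow \<zeta> w v)"
  using norm_flow_le[of \<zeta> "- w" "flow \<zeta> w v"] by (simp add: flow_inverse)

section \<open>Canonical systems\<close>

lemma has_vector_derivative_vec:
  assumes "\<And>i. ((\<lambda>x. f x $ i) has_vector_derivative f' $ i) F"
  shows "(f has_vector_derivative f') F"
  unfolding has_vector_derivative_def has_derivative_def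
proof (intro conjI vec_tendstoI)
  fix i
  show "((\<lambda>x. ((f x - f (Lim F (\<lambda>x. x)) - (x - Lim F (\<lambda>x. x)) *\<^sub>R f') /\<^sub>R norm (x - Lim F (\<lambda>x. x))) $ i) \<longlongrightarrow> 0 $ i) F"
    using assms[of i] by (simp add: has_vector_derivative_def has_derivative_def)
qed (rule bounded_linear_scaleR_left)

text \<open>Gronwall argument with a weighted maximum norm. With weight
  \<open>exp (- (2 * C * s))\<close>, integrating the bound up to a maximum point \<open>a\<close>
  returns less than half of the maximum, which is therefore zero.\<close>

lemma integral_equation_zero:
  fixes D g :: "real \<Rightarrow> 'a::banach"
  assumes int: "\<And>t. t \<ge> 0 \<Longrightarrow> (g has_integral D t) {0..t}"
    and bound: "\<And>s. s \<ge> 0 \<Longrightarrow> norm (g s) \<le> C * norm (D s)"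
    and C: "C > 0" and T: "T \<ge> 0"
  shows "D T = 0"
proof -
  have "continuous_on {0..T} (\<lambda>x. integral {0..x} g)"
    by (rule indefinite_integral_continuous_1) (use int[OF T] in auto)
  then have "continuous_on {0..T} D"
    by (rule continuous_on_eq) (use int integral_unique in auto)
  then have "continuous_on {0..T} (\<lambda>s. exp (- (2 * C * s)) * norm (D s))"
    by (intro continuous_intros)
  then have "\<exists>a\<in>{0..T}. \<forall>s\<in>{0..T}. exp (- (2 * C * s)) * norm (D s) \<le> exp (- (2 * C * a)) * norm (D a)"
    using T by (intro continuous_attains_sup) auto
  then obtain a where a: "a \<in> {0..T}"
    and max: "\<And>s. s \<in> {0..T} \<Longrightarrow> exp (- (2 * C * s)) * norm (D s) \<le> exp (- (2 * C * a)) * norm (D a)"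
    by blast
  define \<mu> where "\<mu> = exp (- (2 * C * a)) * norm (D a)"
  have Da: "norm (D a) = \<mu> * exp (2 * C * a)" by (simp add: \<mu>_def exp_minus)
  have le: "norm (D s) \<le> \<mu> * exp (2 * C * s)" if "s \<in> {0..T}" for s
    using max[OF that] by (simp add: \<mu>_def exp_minus field_simps)
  have hi: "((\<lambda>s. C * \<mu> * exp (2 * C * s)) has_integral (\<mu> / 2 * exp (2 * C * a) - \<mu> / 2 * exp (2 * C * 0))) {0..a}"
  proof (rule fundamental_theorem_of_calculus)
    show "0 \<le> a" using a by simp
    show "((\<lambda>s. \<mu> / 2 * exp (2 * C * s)) has_vector_derivative C * \<mu> * exp (2 * C * s)) (at s within {0..a})" for s
      unfolding has_real_derivative_iff_has_vector_derivative[symmetric]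
      by (rule derivative_eq_intros refl | simp)+
  qed
  have "norm (integral {0..a} g) \<le> integral {0..a} (\<lambda>s. C * \<mu> * exp (2 * C * s))"
  proof (rule integral_norm_bound_integral)
    show "g integrable_on {0..a}" using int a by auto
    show "(\<lambda>s. C * \<mu> * exp (2 * C * s)) integrable_on {0..a}" using hi by auto
    show "norm (g s) \<le> C * \<mu> * exp (2 * C * s)" if "s \<in> {0..a}" for s
    proof -
      have "norm (g s) \<le> C * norm (D s)" using that bound by simp
      also have "\<dots> \<le> C * (\<mu> * exp (2 * C * s))" using C le that a by (intro mult_left_mono) auto
      finally show ?thesis by simp
    qed
  qed
  also have "\<dots> = \<mu> / 2 * exp (2 * C * a) - \<mu> / 2" using integral_unique[OF hi] by simp
  also have "integral {0..a} g = D a" using int a by (auto intro: integral_unique)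
  finally have "\<mu> * exp (2 * C * a) \<le> \<mu> / 2 * exp (2 * C * a) - \<mu> / 2" by (simp add: Da)
  moreover have "\<mu> \<ge> 0" by (simp add: \<mu>_def)
  moreover have "\<mu> * exp (2 * C * a) \<ge> 0" by (simp add: \<mu>_def)
  ultimately have "\<mu> = 0" by linarith
  then show ?thesis using le[of T] T by simp
qed

section \<open>The canonical system in coordinates and uniqueness of W\<close>

lemma mat2_eqI:
  fixes X Y :: "'a^2^2"
  assumes "X $ 1 $ 1 = Y $ 1 $ 1" "X $ 1 $ 2 = Y $ 1 $ 2" "X $ 2 $ 1 = Y $ 2 $ 1" "X $ 2 $ 2 = Y $ 2 $ 2"
  shows "X = Y"
  using assms by (simp add: vec_eq_iff forall_2)

lemma mat2_mult_nth: "((X::complex^2^2) ** Y) $ i $ j = X $ i $ 1 * Y $ 1 $ j + X $ i $ 2 * Y $ 2 $ j"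
  by (simp add: matrix_matrix_mult_def sum_2)

lemma mat2_nth [simp]:
  "(mat c :: complex^2^2) $ 1 $ 1 = c" "(mat c :: complex^2^2) $ 1 $ 2 = 0"
  "(mat c :: complex^2^2) $ 2 $ 1 = 0" "(mat c :: complex^2^2) $ 2 $ 2 = c"
  by (simp_all add: mat_def)

definition rhs :: "(real \<Rightarrow> real^2^2) \<Rightarrow> complex \<Rightarrow> real \<Rightarrow> complex^2^2 \<Rightarrow> complex^2^2" where
  "rhs H z s X = mat z ** X ** cmat (H s) ** (- Jmat)"

lemma rhs_nth:
  "rhs H z s X $ i $ 1 = - z * (X $ i $ 1 * H s $ 1 $ 2 + X $ i $ 2 * H s $ 2 $ 2)"
  "rhs H z s X $ i $ 2 = z * (X $ i $ 1 * H s $ 1 $ 1 + X $ i $ 2 * H s $ 2 $ 1)"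
proof -
  have "(mat z ** X) $ i $ j = z * X $ i $ j" for j
    using exhaust_2[of i] by (auto simp: mat2_mult_nth)
  moreover have "(- Jmat) $ 1 $ 1 = 0" "(- Jmat) $ 1 $ 2 = 1" "(- Jmat) $ 2 $ 1 = - 1" "(- Jmat) $ 2 $ 2 = 0"
    by (simp_all add: Jmat_def)
  moreover have "cmat A $ j $ k = complex_of_real (A $ j $ k)" for A j k
    by (simp add: cmat_def)
  ultimately show "rhs H z s X $ i $ 1 = - z * (X $ i $ 1 * H s $ 1 $ 2 + X $ i $ 2 * H s $ 2 $ 2)"
    "rhs H z s X $ i $ 2 = z * (X $ i $ 1 * H s $ 1 $ 1 + X $ i $ 2 * H s $ 2 $ 1)"
    unfolding rhs_def mat2_mult_nth[of _ "- Jmat"] mat2_mult_nth[of _ "cmat (H s)"]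
    by (simp_all add: algebra_simps)
qed

lemma rhs_diff: "rhs H z s (X - Y) = rhs H z s X - rhs H z s Y"
  by (intro mat2_eqI) (simp_all add: rhs_nth algebra_simps)

text \<open>The equation acts from the right, so a constant left factor preserves solutions and
  allows a change of normalisation.\<close>

lemma rhs_mult_left: "rhs H z s (U ** X) = U ** rhs H z s X"
  by (intro mat2_eqI) (simp_all add: rhs_nth mat2_mult_nth algebra_simps)

lemma norm_mat2_le: "norm (X::complex^2^2) \<le> cmod (X$1$1) + cmod (X$1$2) + cmod (X$2$1) + cmod (X$2$2)"
proof -
  have row: "norm (v::complex^2) \<le> cmod (v$1) + cmod (v$2)" for v
    using L2_set_le_sum[of UNIV "\<lambda>i. norm (v$i)"] by (simp add: norm_vec_def sum_2)
  have "norm X \<le> norm (X$1) + norm (X$2)"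
    using L2_set_le_sum[of UNIV "\<lambda>i. norm (X$i)"] by (simp add: norm_vec_def[of X] sum_2)
  then show ?thesis using row[of "X$1"] row[of "X$2"] by linarith
qed

lemma cmod_entry_le: "cmod ((X::complex^2^2) $ i $ j) \<le> norm X"
  by (rule order_trans[OF Finite_Cartesian_Product.norm_nth_le Finite_Cartesian_Product.norm_nth_le])

lemma Theta_entry_le: "\<bar>Theta \<zeta> $ i $ j\<bar> \<le> 1"
proof -
  have "(cmod (hx \<zeta>))\<^sup>2 \<le> 1" "(hy \<zeta>)\<^sup>2 \<le> 1"
    using hx_hy_unit[of \<zeta>] zero_le_power2[of "hy \<zeta>"] zero_le_power2[of "cmod (hx \<zeta>)"] by linarith+
  moreover have "\<bar>hy \<zeta>\<bar> \<le> 1" using calculation(2) by (simp add: abs_square_le_1)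
  moreover have "\<bar>Re (hx \<zeta>)\<bar> \<le> 1"
    using calculation(1) abs_Re_le_cmod[of "hx \<zeta>"] by (simp add: abs_square_le_1)
  ultimately have "\<bar>hy \<zeta> * Re (hx \<zeta>)\<bar> \<le> 1" by (simp add: abs_mult mult_le_one)
  then show ?thesis
    using exhaust_2[of i] exhaust_2[of j] \<open>(cmod (hx \<zeta>))\<^sup>2 \<le> 1\<close> \<open>(hy \<zeta>)\<^sup>2 \<le> 1\<close>
    by (auto simp: Theta_entries)
qed

lemma norm_rhs_le:
  assumes "\<And>i j. \<bar>H s $ i $ j\<bar> \<le> 1"
  shows "norm (rhs H z s X) \<le> 8 * cmod z * norm X"
proof -
  have e: "cmod (X $ i $ k * complex_of_real (H s $ k $ j)) \<le> norm X" for i j k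
    using mult_mono[OF cmod_entry_le[of X i k] assms[of k j]] by (simp add: norm_mult)
  have e2: "cmod (X $ i $ 1 * complex_of_real (H s $ 1 $ j) + X $ i $ 2 * complex_of_real (H s $ 2 $ j)) \<le> 2 * norm X"
    for i j
    using norm_triangle_mono[OF e[where i=i and k=1 and j=j] e[where i=i and k=2 and j=j]] by simp
  have 1: "cmod (rhs H z s X $ i $ 1) \<le> 2 * cmod z * norm X" for i
    using mult_left_mono[OF e2[of i 2], of "cmod z"] by (simp add: rhs_nth norm_mult)
  have 2: "cmod (rhs H z s X $ i $ 2) \<le> 2 * cmod z * norm X" for i
    using mult_left_mono[OF e2[of i 1], of "cmod z"] by (simp add: rhs_nth norm_mult)
  show ?thesis using norm_mat2_le[of "rhs H z s X"] 1[of 1] 1[of 2] 2[of 1] 2[of 2] by linarith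
qed

lemma is_W_unique:
  assumes H: "\<And>s i j. s > 0 \<Longrightarrow> \<bar>H s $ i $ j\<bar> \<le> 1"
    and W: "is_W H z W" and W': "is_W H z W'"
  shows "W = W'"
proof
  fix t
  show "W t = W' t"
  proof (cases "t < 0")
    case True
    then show ?thesis using W W' by (simp add: is_W_def)
  next
    case False
    define D where "D = (\<lambda>t. W t - W' t)"
    have int: "((\<lambda>s. rhs H z s (D s)) has_integral D u) {0..u}" if "u \<ge> 0" for u
      using has_integral_diff[of "\<lambda>s. rhs H z s (W s)" "W u - mat 1" "{0..u}" "\<lambda>s. rhs H z s (W' s)" "W' u - mat 1"]
        W W' that by (simp add: is_W_def rhs_diff D_def rhs_def[symmetric])
    have "D t = 0"
    proof (rule integral_equation_zero[OF int])
      \<comment> \<open>The summand 1 keeps the constant positive for \<open>z = 0\<close>. At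
        \<open>s = 0\<close> the entries of \<open>H\<close> are not controlled, but
        \<open>D\<close> vanishes there.\<close>
      show "norm (rhs H z s (D s)) \<le> (8 * cmod z + 1) * norm (D s)" if "s \<ge> 0" for s
      proof (cases "s = 0")
        case True
        have "D 0 = 0" using has_integral_unique[OF int[of 0], of 0] by auto
        moreover have "rhs H z 0 0 = 0" by (intro mat2_eqI) (simp_all add: rhs_nth)
        ultimately show ?thesis using True by simp
      next
        case False
        then have "norm (rhs H z s (D s)) \<le> 8 * cmod z * norm (D s)"
          using that H by (intro norm_rhs_le) auto
        then show ?thesis by (simp add: algebra_simps add_increasing)
      qed
      show "8 * cmod z + 1 > 0" by (simp add: add_nonneg_pos)
    qed (use False in auto)
    then show ?thesis by (simp add: D_def)
  qed
qed

text \<open>The matrix of \<open>flow \<zeta> w\<close>, used as a right factor: the fundamental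
  matrix of a constant piece.\<close>

definition mflow :: "rsphere \<Rightarrow> complex \<Rightarrow> complex^2^2" where
  "mflow \<zeta> w = vector [
     vector [cs (eta \<zeta>) w - sn (eta \<zeta>) w * complex_of_real (hy \<zeta> * Re (hx \<zeta>)), sn (eta \<zeta>) w * complex_of_real ((cmod (hx \<zeta>))\<^sup>2)],
     vector [- sn (eta \<zeta>) w * complex_of_real ((hy \<zeta>)\<^sup>2), cs (eta \<zeta>) w + sn (eta \<zeta>) w * complex_of_real (hy \<zeta> * Re (hx \<zeta>))]]"

lemma mflow_nth:
  "mflow \<zeta> w $ 1 $ 1 = cs (eta \<zeta>) w - sn (eta \<zeta>) w * complex_of_real (hy \<zeta> * Re (hx \<zeta>))"
  "mflow \<zeta> w $ 1 $ 2 = sn (eta \<zeta>) w * complex_of_real ((cmod (hx \<zeta>))\<^sup>2)"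
  "mflow \<zeta> w $ 2 $ 1 = - sn (eta \<zeta>) w * complex_of_real ((hy \<zeta>)\<^sup>2)"
  "mflow \<zeta> w $ 2 $ 2 = cs (eta \<zeta>) w + sn (eta \<zeta>) w * complex_of_real (hy \<zeta> * Re (hx \<zeta>))"
  by (simp_all add: mflow_def)

text \<open>A row \<open>(r\<^sub>1, r\<^sub>2)\<close> of W is encoded as the column \<open>(- r\<^sub>2, r\<^sub>1)\<close>; the flow then acts on it
  by the inverse matrix.\<close>
definition rowv :: "complex^2^2 \<Rightarrow> 2 \<Rightarrow> complex \<times> complex" where
  "rowv X i = (- X $ i $ 2, X $ i $ 1)"

lemma rowv_mflow: "rowv (X ** mflow \<zeta> w) i = flow \<zeta> (- w) (rowv X i)"
  by (simp add: rowv_def mat2_mult_nth mflow_nth flow_def gen_def algebra_simps)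

lemma rowv_eqI: "rowv X 1 = rowv Y 1 \<Longrightarrow> rowv X 2 = rowv Y 2 \<Longrightarrow> X = Y"
  by (intro mat2_eqI) (simp_all add: rowv_def)

lemma mflow_inverse: "(X::complex^2^2) ** mflow \<zeta> (- w) ** mflow \<zeta> w = X"
  by (intro rowv_eqI) (simp_all add: rowv_mflow flow_inverse)

lemma cs_derivative:
  "((\<lambda>s. cs \<eta> (z * complex_of_real (s - c))) has_vector_derivative
     - (complex_of_real \<eta>)\<^sup>2 * sn \<eta> (z * complex_of_real (s - c)) * z) (at s)"
proof -
  have "((\<lambda>u. cs \<eta> (z * (u - complex_of_real c))) has_field_derivative
     - (complex_of_real \<eta>)\<^sup>2 * sn \<eta> (z * (complex_of_real s - complex_of_real c)) * z) (at (complex_of_real s))"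
    unfolding cs_def
    by (auto intro!: derivative_eq_intros simp: power2_eq_square mult.assoc eta_sn)
  from has_vector_derivative_real_field[OF this] show ?thesis by simp
qed

lemma sn_derivative:
  "((\<lambda>s. sn \<eta> (z * complex_of_real (s - c))) has_vector_derivative
     cs \<eta> (z * complex_of_real (s - c)) * z) (at s)"
proof -
  have "((\<lambda>u. sn \<eta> (z * (u - complex_of_real c))) has_field_derivative
     cs \<eta> (z * (complex_of_real s - complex_of_real c)) * z) (at (complex_of_real s))"
    unfolding cs_def sn_def
    by (cases "\<eta> = 0") (auto intro!: derivative_eq_intros)
  from has_vector_derivative_real_field[OF this] show ?thesis by simp
qed

text \<open>The factor \<open>(eta \<zeta>)\<^sup>2\<close> from differentiating \<open>cs\<close>
  is the determinant of \<open>Theta \<zeta>\<close>, which matches the right-hand side. As the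
  hypothesis concerns one point, this applies to \<open>H\<close> inside a piece and to a constant
  Hamiltonian on the closed piece.\<close>

lemma mflow_derivative:
  assumes "H s = Theta \<zeta>"
  shows "((\<lambda>s. X ** mflow \<zeta> (z * complex_of_real (s - c))) has_vector_derivative
     rhs H z s (X ** mflow \<zeta> (z * complex_of_real (s - c)))) (at s)"
proof -
  let ?m = "complex_of_real (hy \<zeta> * Re (hx \<zeta>))" and ?p = "complex_of_real ((cmod (hx \<zeta>))\<^sup>2)"
    and ?q = "complex_of_real ((hy \<zeta>)\<^sup>2)"
  have e: "(complex_of_real (eta \<zeta>))\<^sup>2 = ?p * ?q - ?m\<^sup>2"
    unfolding of_real_power[symmetric] eta_square[symmetric] by simp
  have d: "((\<lambda>s. a * (cs (eta \<zeta>) (z * complex_of_real (s - c)) + b * sn (eta \<zeta>) (z * complex_of_real (s - c)))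
      + d * sn (eta \<zeta>) (z * complex_of_real (s - c))) has_vector_derivative
      a * (- (complex_of_real (eta \<zeta>))\<^sup>2 * sn (eta \<zeta>) (z * complex_of_real (s - c)) * z
         + b * (cs (eta \<zeta>) (z * complex_of_real (s - c)) * z)) + d * (cs (eta \<zeta>) (z * complex_of_real (s - c)) * z)) (at s)"
    for a b d
    by (intro has_vector_derivative_add has_vector_derivative_mult_right cs_derivative sn_derivative)
  have "((\<lambda>s. (X ** mflow \<zeta> (z * complex_of_real (s - c))) $ i $ 1) has_vector_derivative
     rhs H z s (X ** mflow \<zeta> (z * complex_of_real (s - c))) $ i $ 1) (at s)" for i
    using d[of "X $ i $ 1" "- ?m" "- X $ i $ 2 * ?q"]
    unfolding e by (simp only: mat2_mult_nth mflow_nth rhs_nth assms Theta_entries)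
       (simp add: power2_eq_square algebra_simps)
  moreover have "((\<lambda>s. (X ** mflow \<zeta> (z * complex_of_real (s - c))) $ i $ 2) has_vector_derivative
     rhs H z s (X ** mflow \<zeta> (z * complex_of_real (s - c))) $ i $ 2) (at s)" for i
    using d[of "X $ i $ 2" ?m "X $ i $ 1 * ?p"]
    unfolding e by (simp only: mat2_mult_nth mflow_nth rhs_nth assms Theta_entries)
       (simp add: power2_eq_square algebra_simps)
  ultimately have "((\<lambda>s. (X ** mflow \<zeta> (z * complex_of_real (s - c))) $ i $ j) has_vector_derivative
     rhs H z s (X ** mflow \<zeta> (z * complex_of_real (s - c))) $ i $ j) (at s)" for i j
    using exhaust_2[of j] by auto
  then show ?thesis by (intro has_vector_derivative_vec)
qed

lemma mflow_0: "(X::complex^2^2) ** mflow \<zeta> 0 = X"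
  by (intro mat2_eqI) (simp_all add: mat2_mult_nth mflow_nth)

lemma norm_le_rowv: "norm (X::complex^2^2) \<le> 2 * norm (rowv X 1) + 2 * norm (rowv X 2)"
proof -
  have "cmod (X $ i $ 1) \<le> norm (rowv X i)" "cmod (X $ i $ 2) \<le> norm (rowv X i)" for i
    using norm_fst_le[where x="- X $ i $ 2" and y="X $ i $ 1"] norm_snd_le[where x="- X $ i $ 2" and y="X $ i $ 1"] by (simp_all add: rowv_def)
  from this[of 1] this[of 2] show ?thesis using norm_mat2_le[of X] by linarith
qed

definition wronskian :: "complex^2^2 \<Rightarrow> complex" where
  "wronskian X = X $ 1 $ 1 * X $ 2 $ 2 - X $ 1 $ 2 * X $ 2 $ 1"

lemma wronskian_mult: "wronskian (X ** Y) = wronskian X * wronskian Y"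
  by (simp add: wronskian_def mat2_mult_nth algebra_simps)

lemma wronskian_mflow: "wronskian (mflow \<zeta> w) = 1"
proof -
  have "wronskian (mflow \<zeta> w) = (cs (eta \<zeta>) w)\<^sup>2
    + complex_of_real ((cmod (hx \<zeta>))\<^sup>2 * (hy \<zeta>)\<^sup>2 - (hy \<zeta> * Re (hx \<zeta>))\<^sup>2) * (sn (eta \<zeta>) w)\<^sup>2"
    by (simp add: wronskian_def mflow_nth power2_eq_square algebra_simps)
  then show ?thesis using cs_sn_square by (simp add: eta_square)
qed

lemma bounded_linear_mat2_mult: "bounded_linear (\<lambda>X::complex^2^2. (U::complex^2^2) ** X)"
proof -
  have "linear (\<lambda>X::complex^2^2. U ** X)"
    by (rule linearI; intro vec_eq_iff[THEN iffD2] allI)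
       (simp_all add: matrix_matrix_mult_def sum_2 algebra_simps)
  then show ?thesis by (simp add: linear_conv_bounded_linear)
qed

section \<open>Piecewise constant Hamiltonians\<close>

text \<open>Here \<open>\<tau> n\<close> is \<open>t\<^sub>n\<^sub>+\<^sub>1\<close>, so that \<open>Z n\<close> is the value on \<open>(\<tau> n, \<tau> (n - 1)]\<close> for \<open>n \<ge> 1\<close>, and
  \<open>Z 0\<close> the value on \<open>(1, \<infinity>)\<close>.\<close>
locale step_hamiltonian =
  fixes \<tau> :: "nat \<Rightarrow> real" and Z :: "nat \<Rightarrow> rsphere" and H :: "real \<Rightarrow> real^2^2"
  assumes tau_0: "\<tau> 0 = 1"
    and tau_pos: "\<And>n. 0 < \<tau> n"
    and tau_dec: "\<And>n. \<tau> (Suc n) < \<tau> n"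
    and tau_lim: "\<tau> \<longlonglongrightarrow> 0"
    and Z_0: "Z 0 = Some 0"
    and Z_in: "\<And>n. Z n \<in> closed_upper"
    and H_piece: "\<And>n s. \<tau> (Suc n) < s \<Longrightarrow> s \<le> \<tau> n \<Longrightarrow> H s = Theta (Z (Suc n))"
    and H_tail: "\<And>s. 1 < s \<Longrightarrow> H s = Theta (Z 0)"
begin

text \<open>Number of the piece containing \<open>s > 0\<close>, counted from the right. Pieces are
  closed on the right, hence \<open>idx (\<tau> n) = Suc n\<close>.\<close>

definition idx :: "real \<Rightarrow> nat" where
  "idx s = (LEAST n. \<tau> n < s)"

lemma tau_antimono: "m \<le> n \<Longrightarrow> \<tau> n \<le> \<tau> m"
  by (rule lift_Suc_antimono_le[of \<tau>, OF less_imp_le[OF tau_dec]])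

lemma tau_idx: "0 < s \<Longrightarrow> \<tau> (idx s) < s"
proof -
  assume "0 < s"
  then have "\<exists>n. \<tau> n < s"
    using eventually_happens'[OF sequentially_bot order_tendstoD(2)[OF tau_lim]] by blast
  then show ?thesis unfolding idx_def by (rule LeastI_ex)
qed

lemma le_tau_idx: "n < idx s \<Longrightarrow> s \<le> \<tau> n"
  using not_less_Least[of n "\<lambda>n. \<tau> n < s"] by (simp add: idx_def not_less)

lemma idx_eqI: "\<tau> n < s \<Longrightarrow> (\<And>m. m < n \<Longrightarrow> s \<le> \<tau> m) \<Longrightarrow> idx s = n"
  unfolding idx_def
proof (rule Least_equality)
  fix m assume "\<And>m. m < n \<Longrightarrow> s \<le> \<tau> m" "\<tau> m < s"
  then show "n \<le> m" using leI[of m n] leD[of s "\<tau> m"] by (cases "m < n") auto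
qed

lemma idx_tau: "idx (\<tau> n) = Suc n"
  by (rule idx_eqI) (auto simp: tau_dec intro: tau_antimono)

lemma idx_between:
  assumes "\<tau> (idx b) < s" "s \<le> b" shows "idx s = idx b"
  using assms(1)
proof (rule idx_eqI)
  show "s \<le> \<tau> m" if "m < idx b" for m using le_tau_idx[OF that] assms(2) by simp
qed

lemma H_idx: "0 < s \<Longrightarrow> H s = Theta (Z (idx s))"
proof (cases "idx s")
  case 0
  assume "0 < s"
  then show ?thesis using tau_idx[of s] 0 H_tail[of s] by (simp add: tau_0)
next
  case (Suc n)
  assume "0 < s"
  then show ?thesis using tau_idx[of s] le_tau_idx[of n s] H_piece[of n s] Suc by simp
qed

lemma H_entry_le: "0 < s \<Longrightarrow> \<bar>H s $ i $ j\<bar> \<le> 1"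
  by (simp add: H_idx Theta_entry_le)

text \<open>Values at the points \<open>\<tau> n\<close> of the solution that is the identity at 1.
  The minus sign is the inverse of a fundamental matrix, since the pieces are crossed
  leftwards.\<close>

primrec node :: "complex \<Rightarrow> nat \<Rightarrow> complex^2^2" where
  "node z 0 = mat 1"
| "node z (Suc n) = node z n ** mflow (Z (Suc n)) (- (z * complex_of_real (\<tau> n - \<tau> (Suc n))))"

text \<open>The solution of the canonical system normalised at 1 instead of 0: it is built from right
  to left, so that only finitely many pieces are involved at each point.\<close>
definition bsol :: "complex \<Rightarrow> real \<Rightarrow> complex^2^2" where
  "bsol z s = node z (idx s) ** mflow (Z (idx s)) (z * complex_of_real (s - \<tau> (idx s)))"

text \<open>At \<open>\<tau> n\<close> the index is already \<open>Suc n\<close>; running that piece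
  forwards undoes the backward step of \<open>node\<close>, so the pieces fit together.\<close>

lemma bsol_tau: "bsol z (\<tau> n) = node z n"
  by (simp add: bsol_def idx_tau mflow_inverse)

lemma bsol_integral_piece:
  assumes "0 < b"
  shows "((\<lambda>s. rhs H z s (bsol z s)) has_integral (bsol z b - node z (idx b))) {\<tau> (idx b)..b}"
proof -
  let ?n = "idx b"
  let ?F = "\<lambda>s. node z ?n ** mflow (Z ?n) (z * complex_of_real (s - \<tau> ?n))"
  have der: "(?F has_vector_derivative rhs H' z s (?F s)) (at s)" if "H' s = Theta (Z ?n)" for H' s
    using that by (rule mflow_derivative)
  have "((\<lambda>s. rhs H z s (bsol z s)) has_integral (?F b - ?F (\<tau> ?n))) {\<tau> ?n..b}"
  \<comment> \<open>Derivatives are needed in the interior only: at \<open>\<tau> ?n\<close> the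
    Hamiltonian already has the value of the piece to the left.\<close>
  proof (rule fundamental_theorem_of_calculus_interior)
    show "\<tau> ?n \<le> b" using tau_idx[OF assms] by simp
    show "continuous_on {\<tau> ?n..b} ?F"
      by (intro continuous_at_imp_continuous_on ballI has_vector_derivative_continuous[OF der[of "\<lambda>_. Theta (Z ?n)"]] refl)
    show "(?F has_vector_derivative rhs H z s (bsol z s)) (at s)" if "s \<in> {\<tau> ?n<..<b}" for s
    proof -
      have i: "idx s = ?n" using that by (intro idx_between) auto
      have "0 < s" using that tau_pos[of ?n] by simp
      then have "H s = Theta (Z ?n)" using H_idx i by simp
      then show ?thesis using der[of H s] by (simp add: bsol_def i)
    qed
  qed
  then show ?thesis by (simp add: bsol_def mflow_0)
qed

lemma bsol_integral_from_tau:
  assumes "0 < b" "idx b \<le> m"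
  shows "((\<lambda>s. rhs H z s (bsol z s)) has_integral (bsol z b - node z m)) {\<tau> m..b}"
  using assms(2)
proof (induction m rule: dec_induct)
  case base
  then show ?case using bsol_integral_piece[OF assms(1)] .
next
  case (step m)
  have "((\<lambda>s. rhs H z s (bsol z s)) has_integral (node z m - node z (Suc m))) {\<tau> (Suc m)..\<tau> m}"
    using bsol_integral_piece[OF tau_pos[of m], of z] by (simp add: idx_tau bsol_tau)
  moreover have "\<tau> m \<le> b" using tau_idx[OF assms(1)] tau_antimono[OF step(1)] by simp
  ultimately have "((\<lambda>s. rhs H z s (bsol z s)) has_integral
      (node z m - node z (Suc m)) + (bsol z b - node z m)) {\<tau> (Suc m)..b}"
    using step.IH tau_dec[of m] by (intro has_integral_combine[of _ "\<tau> m"]) auto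
  then show ?case by simp
qed

section \<open>Convergence of the backward solution at 0\<close>

definition yv :: "complex \<Rightarrow> 2 \<Rightarrow> nat \<Rightarrow> complex \<times> complex" where
  "yv z i n = rowv (node z n) i"

text \<open>The minus signs of \<open>node\<close> and \<open>rowv_mflow\<close> cancel: on the way
  down to 0 the encoded rows move by the forward flow, the direction in which \<open>imform\<close>
  grows.\<close>

lemma yv_Suc: "yv z i (Suc n) = flow (Z (Suc n)) (z * complex_of_real (\<tau> n - \<tau> (Suc n))) (yv z i n)"
  by (simp add: yv_def rowv_mflow)

lemma cmod_z_step: "cmod (z * complex_of_real (\<tau> n - \<tau> (Suc n))) = cmod z * (\<tau> n - \<tau> (Suc n))"
proof -
  have "cmod (complex_of_real (\<tau> n - \<tau> (Suc n))) = \<tau> n - \<tau> (Suc n)"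
    using tau_dec[of n] by (simp only: norm_of_real)
  then show ?thesis by (simp only: norm_mult)
qed

text \<open>The identity (exp a - 1) exp b + (exp b - 1) = exp (a + b) - 1 makes the bound depend on
  the total length and not on the number of pieces.\<close>

lemma yv_diff_le:
  assumes "n \<le> m"
  shows "norm (yv z i m - yv z i n) \<le> (exp (3 * cmod z * (\<tau> n - \<tau> m)) - 1) * norm (yv z i n)"
  using assms
proof (induction m rule: dec_induct)
  case (step m)
  let ?a = "3 * cmod z * (\<tau> m - \<tau> (Suc m))" and ?b = "3 * cmod z * (\<tau> n - \<tau> m)"
  have "norm (yv z i (Suc m) - yv z i m) \<le> (exp ?a - 1) * norm (yv z i m)"
    using norm_flow_minus_le[of "Z (Suc m)" "z * complex_of_real (\<tau> m - \<tau> (Suc m))" "yv z i m"]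
    unfolding yv_Suc cmod_z_step by (simp only: mult.assoc)
  also have "\<dots> \<le> (exp ?a - 1) * (exp ?b * norm (yv z i n))"
  proof (rule mult_left_mono)
    show "norm (yv z i m) \<le> exp ?b * norm (yv z i n)"
      using step.IH norm_triangle_ineq2[of "yv z i m" "yv z i n"] by (simp add: left_diff_distrib)
    show "0 \<le> exp ?a - 1" using tau_dec[of m] by simp
  qed
  finally have "norm (yv z i (Suc m) - yv z i n) \<le>
      (exp ?a - 1) * (exp ?b * norm (yv z i n)) + (exp ?b - 1) * norm (yv z i n)"
    using step.IH norm_triangle_ineq[of "yv z i (Suc m) - yv z i m" "yv z i m - yv z i n"] by simp
  also have "\<dots> = (exp (?a + ?b) - 1) * norm (yv z i n)"
    unfolding exp_add by (simp add: left_diff_distrib right_diff_distrib)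
  also have "?a + ?b = 3 * cmod z * (\<tau> n - \<tau> (Suc m))" by (simp add: algebra_simps)
  finally show ?case .
qed simp

lemma yv_bounded: "norm (yv z i n) \<le> exp (3 * cmod z) * norm (yv z i 0)"
proof -
  have "norm (yv z i n) \<le> exp (3 * cmod z * (\<tau> 0 - \<tau> n)) * norm (yv z i 0)"
    using yv_diff_le[of 0 n z i] norm_triangle_ineq2[of "yv z i n" "yv z i 0"]
    by (simp add: left_diff_distrib)
  also have "\<dots> \<le> exp (3 * cmod z) * norm (yv z i 0)"
    using tau_pos[of n] by (intro mult_right_mono) (auto simp: tau_0 mult_left_le)
  finally show ?thesis .
qed

definition ylim :: "complex \<Rightarrow> 2 \<Rightarrow> complex \<times> complex" where
  "ylim z i = lim (yv z i)"

text \<open>The sequence is Cauchy: its movement after index \<open>n\<close> is controlled by the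
  remaining length \<open>\<tau> n\<close>.\<close>

lemma yv_lim: "yv z i \<longlonglongrightarrow> ylim z i"
proof -
  let ?K = "exp (3 * cmod z) * norm (yv z i 0) + 1"
  have K: "?K > 0" by (simp add: add_nonneg_pos)
  have lim: "(\<lambda>n. (exp (3 * cmod z * \<tau> n) - 1) * ?K) \<longlonglongrightarrow> (exp (3 * cmod z * 0) - 1) * ?K"
    by (intro tendsto_intros tau_lim)
  have bd: "norm (yv z i m - yv z i n) \<le> (exp (3 * cmod z * \<tau> n) - 1) * ?K" if "n \<le> m" for m n
  proof -
    have "norm (yv z i m - yv z i n) \<le> (exp (3 * cmod z * (\<tau> n - \<tau> m)) - 1) * norm (yv z i n)"
      by (rule yv_diff_le[OF that])
    also have "\<dots> \<le> (exp (3 * cmod z * \<tau> n) - 1) * ?K"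
      using tau_antimono[OF that] tau_pos[of m] tau_pos[of n] yv_bounded[of z i n]
      by (intro mult_mono) (auto intro: mult_left_mono less_imp_le add_increasing2)
    finally show ?thesis .
  qed
  have "Cauchy (yv z i)"
  proof (rule metric_CauchyI)
    fix e :: real assume "e > 0"
    then obtain N where N: "(exp (3 * cmod z * \<tau> N) - 1) * ?K < e / 2"
      using eventually_happens'[OF sequentially_bot order_tendstoD(2)[OF lim, of "e / 2"]] by auto
    have "dist (yv z i m) (yv z i n) < e" if "m \<ge> N" "n \<ge> N" for m n
      using bd[OF that(1)] bd[OF that(2)] N dist_triangle2[of "yv z i m" "yv z i n" "yv z i N"]
      unfolding dist_norm by linarith
    then show "\<exists>M. \<forall>m\<ge>M. \<forall>n\<ge>M. dist (yv z i m) (yv z i n) < e" by blast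
  qed
  then show ?thesis unfolding ylim_def by (simp add: Cauchy_convergent_iff convergent_LIMSEQ_iff)
qed

lemma ylim_diff_le:
  "norm (ylim z i - yv z i n) \<le> (exp (3 * cmod z * \<tau> n) - 1) * norm (yv z i n)"
proof -
  have "(\<lambda>m. norm (yv z i m - yv z i n)) \<longlonglongrightarrow> norm (ylim z i - yv z i n)"
    by (intro tendsto_intros yv_lim)
  moreover have "(\<lambda>m. (exp (3 * cmod z * (\<tau> n - \<tau> m)) - 1) * norm (yv z i n))
      \<longlonglongrightarrow> (exp (3 * cmod z * (\<tau> n - 0)) - 1) * norm (yv z i n)"
    by (intro tendsto_intros tau_lim)
  ultimately have "norm (ylim z i - yv z i n) \<le> (exp (3 * cmod z * (\<tau> n - 0)) - 1) * norm (yv z i n)"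
    by (rule LIMSEQ_le) (use yv_diff_le in blast)
  then show ?thesis by simp
qed

lemma norm_yv_0: "norm (yv z i 0) = 1"
  using exhaust_2[of i] by (auto simp: yv_def rowv_def norm_Pair)

lemma bsol_bounded:
  assumes "0 < s" "s \<le> b"
  shows "norm (bsol z s) \<le> 4 * (exp (3 * (cmod z * b)) * exp (3 * cmod z))"
proof -
  have r: "norm (rowv (bsol z s) i) \<le> exp (3 * (cmod z * b)) * exp (3 * cmod z)" for i
  proof -
    let ?w = "- (z * complex_of_real (s - \<tau> (idx s)))"
    have "cmod ?w = cmod z * \<bar>s - \<tau> (idx s)\<bar>"
      by (simp only: norm_minus_cancel norm_mult norm_of_real)
    also have "\<dots> \<le> cmod z * b"
      using tau_idx[OF assms(1)] tau_pos[of "idx s"] assms by (intro mult_left_mono) auto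
    finally have w: "cmod ?w \<le> cmod z * b" .
    have "rowv (bsol z s) i = flow (Z (idx s)) ?w (yv z i (idx s))"
      by (simp add: bsol_def rowv_mflow yv_def)
    then have "norm (rowv (bsol z s) i) \<le> exp (3 * cmod ?w) * norm (yv z i (idx s))"
      using norm_flow_le by metis
    also have "\<dots> \<le> exp (3 * (cmod z * b)) * exp (3 * cmod z)"
      using w yv_bounded[of z i "idx s"] by (intro mult_mono) (auto simp: norm_yv_0)
    finally show ?thesis .
  qed
  show ?thesis using r[of 1] r[of 2] norm_le_rowv[of "bsol z s"] by linarith
qed

section \<open>The solution normalised at 0 and the Weyl coefficient\<close>

definition bsol0 :: "complex \<Rightarrow> complex^2^2" where
  "bsol0 z = vector [vector [snd (ylim z 1), - fst (ylim z 1)], vector [snd (ylim z 2), - fst (ylim z 2)]]"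

lemma node_lim: "node z \<longlonglongrightarrow> bsol0 z"
proof (intro vec_tendstoI)
  fix i j
  have "(\<lambda>n. snd (yv z i n)) \<longlonglongrightarrow> snd (ylim z i)" "(\<lambda>n. - fst (yv z i n)) \<longlonglongrightarrow> - fst (ylim z i)"
    by (intro tendsto_intros yv_lim)+
  then have "(\<lambda>n. node z n $ i $ 1) \<longlonglongrightarrow> snd (ylim z i)" "(\<lambda>n. node z n $ i $ 2) \<longlonglongrightarrow> - fst (ylim z i)"
    by (simp_all add: yv_def rowv_def)
  then show "(\<lambda>n. node z n $ i $ j) \<longlonglongrightarrow> bsol0 z $ i $ j"
    using exhaust_2[of i] exhaust_2[of j] by (auto simp: bsol0_def)
qed

lemma bsol_integral:
  assumes "0 < b"
  shows "((\<lambda>s. rhs H z s (bsol z s)) has_integral (bsol z b - bsol0 z)) {0..b}"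
proof -
  let ?f = "\<lambda>s. rhs H z s (bsol z s)"
  define C where "C = 8 * cmod z * (4 * (exp (3 * (cmod z * b)) * exp (3 * cmod z)))"
  have C: "norm (?f s) \<le> C" if "0 < s" "s \<le> b" for s
  proof -
    have "norm (?f s) \<le> 8 * cmod z * norm (bsol z s)"
      by (rule norm_rhs_le) (simp add: H_entry_le that)
    also have "\<dots> \<le> C" unfolding C_def
      by (intro mult_left_mono bsol_bounded that) auto
    finally show ?thesis .
  qed
  have C0: "C \<ge> 0" by (simp add: C_def)
  \<comment> \<open>Dominated convergence handles the infinitely many pieces near 0:
    \<open>g k\<close> is cut off to an interval meeting finitely many of them, with the bound
    \<open>C\<close>. All \<open>g k\<close> vanish at 0, so the limit \<open>f0\<close> is given
    the value 0 there.\<close>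
  define g where "g = (\<lambda>k s. if s \<in> {\<tau> (idx b + k)..b} then ?f s else 0)"
  define f0 where "f0 = (\<lambda>s. if s = 0 then 0 else ?f s)"
  have gi: "(g k has_integral (bsol z b - node z (idx b + k))) {0..b}" for k
  proof -
    have "{\<tau> (idx b + k)..b} \<subseteq> {0..b}" using tau_pos[of "idx b + k"] by auto
    then show ?thesis
      unfolding g_def using bsol_integral_from_tau[OF assms, of "idx b + k" z]
      by (simp only: has_integral_restrict[of "{\<tau> (idx b + k)..b}" "{0..b}"])
  qed
  have le: "norm (g k s) \<le> C" if "s \<in> {0..b}" for k s
    using C[of s] C0 that tau_pos[of "idx b + k"] by (auto simp: g_def)
  have conv: "(\<lambda>k. g k s) \<longlonglongrightarrow> f0 s" if "s \<in> {0..b}" for s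
  proof (cases "s = 0")
    case True
    then have "g k s = 0" for k using tau_pos[of "idx b + k"] by (simp add: g_def)
    then show ?thesis using True by (simp add: f0_def)
  next
    case False
    have "g k s = f0 s" if "k \<ge> idx s" for k
    proof -
      have "\<tau> (idx b + k) \<le> \<tau> (idx s)" using that by (intro tau_antimono) simp
      also have "\<dots> < s" using False \<open>s \<in> {0..b}\<close> by (intro tau_idx) simp
      finally show ?thesis using False \<open>s \<in> {0..b}\<close> by (simp add: g_def f0_def)
    qed
    then show ?thesis by (intro tendsto_eventually) (auto simp: eventually_sequentially)
  qed
  have int: "f0 integrable_on {0..b}" and lim: "(\<lambda>k. integral {0..b} (g k)) \<longlonglongrightarrow> integral {0..b} f0"
    using dominated_convergence[of g "{0..b}" "\<lambda>_. C" f0] gi le conv by (auto simp: has_integral_integrable)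
  have "(\<lambda>k. bsol z b - node z (idx b + k)) \<longlonglongrightarrow> bsol z b - bsol0 z"
    using LIMSEQ_ignore_initial_segment[OF node_lim[of z], of "idx b"]
    by (intro tendsto_intros) (simp add: add.commute)
  moreover have "integral {0..b} (g k) = bsol z b - node z (idx b + k)" for k
    using gi integral_unique by blast
  ultimately have "integral {0..b} f0 = bsol z b - bsol0 z"
    using lim LIMSEQ_unique by auto
  then have "(f0 has_integral (bsol z b - bsol0 z)) {0..b}"
    using int by (metis integrable_integral)
  then show ?thesis
    by (rule has_integral_spike_finite[of "{0}", rotated 2]) (auto simp: f0_def)
qed

text \<open>Each step has determinant 1 and this survives the limit, so the value at 0 is
  invertible.\<close>

lemma wronskian_bsol0: "wronskian (bsol0 z) = 1"
proof -
  have "wronskian (node z n) = 1" for n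
    by (induction n) (simp_all add: wronskian_mult wronskian_mflow, simp add: wronskian_def)
  moreover have "(\<lambda>n. wronskian (node z n)) \<longlonglongrightarrow> wronskian (bsol0 z)"
    unfolding wronskian_def by (intro tendsto_intros node_lim)
  ultimately show ?thesis by (simp add: LIMSEQ_const_iff)
qed

text \<open>The adjugate, which is the inverse because the determinant is 1.\<close>

definition bsol0_inv :: "complex \<Rightarrow> complex^2^2" where
  "bsol0_inv z = vector [vector [bsol0 z $ 2 $ 2, - bsol0 z $ 1 $ 2], vector [- bsol0 z $ 2 $ 1, bsol0 z $ 1 $ 1]]"

lemma bsol0_inv: "bsol0_inv z ** bsol0 z = mat 1"
  using wronskian_bsol0[of z]
  by (intro mat2_eqI) (simp_all add: mat2_mult_nth bsol0_inv_def wronskian_def algebra_simps)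

definition fsol :: "complex \<Rightarrow> real \<Rightarrow> complex^2^2" where
  "fsol z s = (if s \<le> 0 then mat 1 else bsol0_inv z ** bsol z s)"

lemma is_W_fsol: "is_W H z (fsol z)"
  unfolding is_W_def rhs_def[symmetric]
proof (intro conjI allI impI)
  fix b :: real assume b: "0 \<le> b"
  show "((\<lambda>s. rhs H z s (fsol z s)) has_integral (fsol z b - mat 1)) {0..b}"
  proof (cases "b = 0")
    case True
    then show ?thesis using has_integral_null_real[of b b "\<lambda>s. rhs H z s (fsol z s)"] by (simp add: fsol_def)
  next
    case False
    then have b: "0 < b" using b by simp
    have "((\<lambda>s. bsol0_inv z ** rhs H z s (bsol z s)) has_integral bsol0_inv z ** (bsol z b - bsol0 z)) {0..b}"
      using has_integral_linear[OF bsol_integral[OF b] bounded_linear_mat2_mult] by (simp add: o_def)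
    moreover have "bsol0_inv z ** (bsol z b - bsol0 z) = fsol z b - mat 1"
      using b linear_diff[OF bounded_linear.linear[OF bounded_linear_mat2_mult]]
      by (simp add: fsol_def bsol0_inv)
    ultimately have "((\<lambda>s. bsol0_inv z ** rhs H z s (bsol z s)) has_integral (fsol z b - mat 1)) {0..b}"
      by simp
    then show ?thesis
      by (rule has_integral_spike_finite[of "{0}", rotated 2]) (auto simp: fsol_def rhs_mult_left)
  qed
qed (simp add: fsol_def)

lemma Wsol_eq: "Wsol H z = fsol z"
  unfolding Wsol_def
proof (rule the_equality)
  show "is_W H z (fsol z)" by (rule is_W_fsol)
  show "W = fsol z" if "is_W H z W" for W
    by (rule is_W_unique[OF _ that is_W_fsol]) (rule H_entry_le)
qed

text \<open>For \<open>Theta (Some 0)\<close> the fundamental matrix is lower triangular with unit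
  diagonal, so as a right factor it fixes the second column; what remains is the second column of
  the adjugate.\<close>

lemma fsol_column_2:
  assumes "1 < s"
  shows "fsol z s $ 1 $ 2 = fst (ylim z 1)" "fsol z s $ 2 $ 2 = snd (ylim z 1)"
proof -
  have "idx s = 0" using assms by (intro idx_eqI) (auto simp: tau_0)
  then have "bsol z s = mflow (Some 0) (z * complex_of_real (s - 1))"
    by (simp add: bsol_def Z_0 tau_0 matrix_mul_lid)
  then show "fsol z s $ 1 $ 2 = fst (ylim z 1)" "fsol z s $ 2 $ 2 = snd (ylim z 1)"
    using assms
    by (simp_all add: fsol_def mat2_mult_nth mflow_nth bsol0_inv_def bsol0_def eta_def hx_def hy_def cs_def)
qed

text \<open>The quotient is constant beyond 1, so its limit is this constant, and it is unique
  because \<open>chordal\<close> separates points.\<close>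

lemma weyl_coeff_eq: "weyl_coeff H z = rs_div (fst (ylim z 1)) (snd (ylim z 1))" (is "_ = ?q")
proof -
  have "((\<lambda>s. chordal (rs_div (Wsol H z s $ 1 $ 2) (Wsol H z s $ 2 $ 2)) \<xi>) \<longlongrightarrow> 0) at_top \<longleftrightarrow> \<xi> = ?q" for \<xi>
  proof -
    have "\<forall>\<^sub>F s in at_top. chordal (rs_div (Wsol H z s $ 1 $ 2) (Wsol H z s $ 2 $ 2)) \<xi> = chordal ?q \<xi>"
      using eventually_gt_at_top[of 1] by eventually_elim (simp add: Wsol_eq fsol_column_2)
    then have "((\<lambda>s. chordal (rs_div (Wsol H z s $ 1 $ 2) (Wsol H z s $ 2 $ 2)) \<xi>) \<longlongrightarrow> 0) at_top
        \<longleftrightarrow> ((\<lambda>s::real. chordal ?q \<xi>) \<longlongrightarrow> 0) at_top"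
      by (rule tendsto_cong)
    also have "\<dots> \<longleftrightarrow> chordal ?q \<xi> = 0" by (simp add: tendsto_const_iff)
    finally show ?thesis by (auto simp: chordal_eq_0_iff)
  qed
  then show ?thesis unfolding weyl_coeff_def by simp
qed

end

section \<open>Asymptotics of the Weyl coefficient\<close>

lemma Im_ge_Gamma_sector:
  assumes "0 < \<alpha>" "\<alpha> \<le> pi / 2" "z \<in> Gamma_sector \<alpha>"
  shows "sin \<alpha> * cmod z \<le> Im z"
proof -
  have a: "\<alpha> \<le> Arg z" "Arg z \<le> pi - \<alpha>" using assms(3) by (auto simp: Gamma_sector_def)
  have "sin \<alpha> \<le> sin (Arg z)"
  proof (cases "Arg z \<le> pi / 2")
    case True
    then show ?thesis using a assms by (intro sin_monotone_2pi_le) auto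
  next
    case False
    then have "sin \<alpha> \<le> sin (pi - Arg z)" using a assms by (intro sin_monotone_2pi_le) auto
    then show ?thesis by simp
  qed
  then have "sin \<alpha> * cmod z \<le> sin (Arg z) * cmod z" by (intro mult_right_mono) auto
  also have "\<dots> = Im (rcis (cmod z) (Arg z))" by simp
  finally show ?thesis by (simp only: rcis_cmod_Arg)
qed

context step_hamiltonian
begin

text \<open>Row 1 starts at (0, 1), where the form is 0, and no step makes it negative.\<close>

lemma imform_yv_nonneg:
  assumes "0 \<le> Im z"
  shows "0 \<le> imform (yv z 1 n)"
proof (induction n)
  case 0
  show ?case by (simp add: imform_def yv_def rowv_def)
next
  case (Suc n)
  let ?w = "z * complex_of_real (\<tau> n - \<tau> (Suc n))"
  have w: "0 \<le> Im ?w" using assms tau_dec[of n] by simp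
  have "0 \<le> Im ?w * (cmod (wedge (Z (Suc n)) (yv z 1 (Suc n))))\<^sup>2" using w by (intro mult_nonneg_nonneg) auto
  then show ?case using imform_flow_ge[OF Z_in w Suc, of "Suc n"] by (simp add: yv_Suc)
qed

text \<open>The form at the left end is squeezed between \<open>Im z\<close> times the length times
  the squared \<open>wedge\<close> and half the squared norm.\<close>

lemma wedge_yv_attracted:
  assumes "0 \<le> Im z" "0 < \<delta>" and large: "1 / (2 * \<delta>\<^sup>2) \<le> Im z * (\<tau> n - \<tau> (Suc n))"
  shows "cmod (wedge (Z (Suc n)) (yv z 1 (Suc n))) \<le> \<delta> * norm (yv z 1 (Suc n))"
proof -
  let ?w = "z * complex_of_real (\<tau> n - \<tau> (Suc n))" and ?v = "yv z 1 (Suc n)"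
  let ?h = "cmod (wedge (Z (Suc n)) ?v)"
  have w: "0 \<le> Im ?w" using assms tau_dec[of n] by simp
  have "1 / (2 * \<delta>\<^sup>2) * ?h\<^sup>2 \<le> Im z * (\<tau> n - \<tau> (Suc n)) * ?h\<^sup>2"
    using large by (intro mult_right_mono) auto
  also have "\<dots> \<le> imform ?v"
    using imform_flow_ge[OF Z_in w imform_yv_nonneg[OF assms(1)], of "Suc n" n] by (simp add: yv_Suc)
  also have "\<dots> \<le> (norm ?v)\<^sup>2 / 2" by (rule imform_le)
  finally have "?h\<^sup>2 \<le> (\<delta> * norm ?v)\<^sup>2" using assms(2) by (simp add: field_simps)
  then show ?thesis by (rule power2_le_imp_le) (use assms(2) in simp)
qed

text \<open>The flow does not increase \<open>wedge\<close>; the relative distance is worsened only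
  by the change of reference point and by a possible loss of norm, which is at most the exponential
  factor.\<close>

lemma wedge_yv_transport:
  assumes "0 \<le> Im z" and "cmod (wedge (Z n) (yv z 1 n)) \<le> \<delta> * norm (yv z 1 n)"
  shows "cmod (wedge (Z (Suc n)) (yv z 1 (Suc n)))
    \<le> exp (3 * (cmod z * \<tau> n)) * (\<delta> + chordal (Z n) (Z (Suc n))) * norm (yv z 1 (Suc n))"
proof -
  let ?w = "z * complex_of_real (\<tau> n - \<tau> (Suc n))" and ?v = "yv z 1 n" and ?c = "chordal (Z n) (Z (Suc n))"
  have w: "0 \<le> Im ?w" using assms tau_dec[of n] by simp
  have c: "0 \<le> ?c" by (rule chordal_nonneg)
  have pos: "0 \<le> (\<delta> + ?c) * norm ?v"
    using assms(2) norm_ge_zero[of "wedge (Z n) ?v"] mult_nonneg_nonneg[OF c norm_ge_zero[of ?v]]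
    unfolding distrib_right by linarith
  have "cmod (wedge (Z (Suc n)) (yv z 1 (Suc n))) \<le> cmod (wedge (Z (Suc n)) ?v)"
    unfolding yv_Suc by (rule wedge_flow_le[OF Z_in w])
  also have "\<dots> \<le> cmod (wedge (Z n) ?v) + ?c / 2 * norm ?v" by (rule wedge_triangle)
  also have "\<dots> \<le> (\<delta> + ?c) * norm ?v"
    using assms(2) mult_nonneg_nonneg[OF c norm_ge_zero[of ?v]] by (simp add: distrib_right)
  finally have 1: "cmod (wedge (Z (Suc n)) (yv z 1 (Suc n))) \<le> (\<delta> + ?c) * norm ?v" .
  show ?thesis
  proof (cases "?v = 0")
    case True
    then have "wedge (Z (Suc n)) (yv z 1 (Suc n)) = 0" using 1 by simp
    moreover have "yv z 1 (Suc n) = 0" using True by (simp add: yv_Suc flow_def gen_def zero_prod_def)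
    ultimately show ?thesis by simp
  next
    case False
    then have d: "0 \<le> \<delta> + ?c" using pos by (simp add: zero_le_mult_iff)
    have "norm ?v \<le> exp (3 * cmod ?w) * norm (yv z 1 (Suc n))"
      unfolding yv_Suc by (rule norm_flow_ge)
    also have "\<dots> \<le> exp (3 * (cmod z * \<tau> n)) * norm (yv z 1 (Suc n))"
      unfolding cmod_z_step using tau_pos[of "Suc n"] by (intro mult_right_mono) (auto intro: mult_left_mono)
    finally have "(\<delta> + ?c) * norm ?v \<le> (\<delta> + ?c) * (exp (3 * (cmod z * \<tau> n)) * norm (yv z 1 (Suc n)))"
      using d by (rule mult_left_mono)
    then show ?thesis using 1 by (simp add: mult_ac)
  qed
qed

lemma ylim_nonzero: "ylim z 1 \<noteq> 0"
proof
  assume "ylim z 1 = 0"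
  then have "wronskian (bsol0 z) = 0" by (simp add: wronskian_def bsol0_def)
  then show False by (simp add: wronskian_bsol0)
qed

text \<open>On the scale |z| only the piece containing 1/|z| and its two neighbours matter.\<close>
lemma weyl_coeff_near_Z:
  assumes ratio: "(\<lambda>n. \<tau> (Suc n) / \<tau> n) \<longlonglongrightarrow> 0"
    and Zlim: "(\<lambda>n. chordal (Z (Suc n)) (Z n)) \<longlonglongrightarrow> 0"
    and \<alpha>: "0 < \<alpha>" "\<alpha> \<le> pi / 2" and \<epsilon>: "0 < \<epsilon>"
  shows "\<exists>N. \<forall>n\<ge>N. \<forall>z\<in>Gamma_sector \<alpha>. cmod z * \<tau> (Suc n) \<le> 1 \<longrightarrow> 1 \<le> cmod z * \<tau> n \<longrightarrow>
      chordal (weyl_coeff H z) (Z (Suc n)) < \<epsilon>"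
proof -
  define s where "s = sin \<alpha>"
  have s: "0 < s" unfolding s_def using \<alpha> by (intro sin_gt_zero) auto
  define E where "E = exp (3::real)"
  have E: "1 \<le> E" by (simp add: E_def)
  \<comment> \<open>The errors below add up to \<open>16 * (E * d)\<close>, hence the 20;
    \<open>d \<le> 1 / 2\<close> lets the tail error be absorbed into the norm.\<close>
  define d where "d = min (\<epsilon> / (20 * E)) (1 / 2)"
  have d: "0 < d" "d \<le> 1 / 2" "20 * (E * d) \<le> \<epsilon>"
    using \<epsilon> E by (auto simp: d_def min_def field_simps)
  \<comment> \<open>If \<open>R \<le> cmod z * \<tau> n\<close>, the current piece attracts to
    within \<open>d\<close>; the summand 1 pays for \<open>cmod z * \<tau> (Suc n) \<le> 1\<close>.
    Otherwise crossing it costs at most \<open>exp (3 * R)\<close>, for which \<open>d'\<close>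
    compensates.\<close>
  define R where "R = 1 / (2 * d\<^sup>2 * s) + 1"
  define d' where "d' = d * exp (- (3 * R)) / 2"
  have R: "0 < R" using d s by (simp add: R_def add_pos_pos)
  have d': "0 < d'" using d by (simp add: d'_def)
  have "d * exp (- (3 * R)) \<le> d * 1" using R d by (intro mult_left_mono) auto
  then have d'd: "d' \<le> d" unfolding d'_def using d by linarith
  \<comment> \<open>A ratio below \<open>\<kappa>\<close> makes the preceding piece long enough to
    attract to within \<open>d'\<close>.\<close>
  define \<kappa> where "\<kappa> = 1 / (1 / (2 * d'\<^sup>2 * s) + 1)"
  have \<kappa>: "0 < \<kappa>" using d' s by (simp add: \<kappa>_def add_pos_pos)
  have "(\<lambda>n. exp (3 * (\<tau> (Suc n) / \<tau> n)) - 1) \<longlonglongrightarrow> exp (3 * 0) - 1"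
    by (intro tendsto_intros ratio)
  then have "\<forall>\<^sub>F n in sequentially. exp (3 * (\<tau> (Suc n) / \<tau> n)) - 1 < d"
    using d(1) by (intro order_tendstoD(2)[of _ "exp (3 * 0) - 1"]) simp_all
  then have "\<forall>\<^sub>F n in sequentially. exp (3 * (\<tau> (Suc n) / \<tau> n)) - 1 < d \<and>
      \<tau> (Suc n) / \<tau> n < \<kappa> \<and> chordal (Z (Suc n)) (Z n) < d'"
    using order_tendstoD(2)[OF ratio \<kappa>] order_tendstoD(2)[OF Zlim d'] by eventually_elim auto
  then obtain N where N: "\<And>n. n \<ge> N \<Longrightarrow> exp (3 * (\<tau> (Suc n) / \<tau> n)) - 1 < d"
      "\<And>n. n \<ge> N \<Longrightarrow> \<tau> (Suc n) / \<tau> n < \<kappa>" "\<And>n. n \<ge> N \<Longrightarrow> chordal (Z n) (Z (Suc n)) < d'"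
    by (auto simp: eventually_sequentially chordal_commute)
  have "chordal (weyl_coeff H z) (Z (Suc n)) < \<epsilon>"
    if n: "n \<ge> Suc N" and z: "z \<in> Gamma_sector \<alpha>" and z1: "cmod z * \<tau> (Suc n) \<le> 1" and z2: "1 \<le> cmod z * \<tau> n" for n z
  proof -
    have Im0: "0 \<le> Im z" using z by (simp add: Gamma_sector_def)
    have Im: "s * cmod z \<le> Im z" unfolding s_def by (rule Im_ge_Gamma_sector[OF \<alpha> z])
    have step: "s * (cmod z * \<tau> k - cmod z * \<tau> (Suc k)) \<le> Im z * (\<tau> k - \<tau> (Suc k))" for k
      using mult_right_mono[OF Im, of "\<tau> k - \<tau> (Suc k)"] tau_dec[of k] by (simp add: algebra_simps)
    have 1: "cmod (wedge (Z (Suc n)) (yv z 1 (Suc n))) \<le> d * norm (yv z 1 (Suc n))"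
    proof (cases "R \<le> cmod z * \<tau> n")
      case True
      have "1 / (2 * d\<^sup>2) = s * (R - 1)" using s by (simp add: R_def field_simps)
      also have "\<dots> \<le> s * (cmod z * \<tau> n - cmod z * \<tau> (Suc n))"
        using True z1 s by (intro mult_left_mono) auto
      finally show ?thesis using step[of n] by (intro wedge_yv_attracted[OF Im0 d(1)]) linarith
    next
      case False
      \<comment> \<open>The current piece may be too short to attract, so the attraction to
        \<open>Z n\<close> takes place on the preceding piece and is then carried over to
        \<open>Z (Suc n)\<close>.\<close>
      obtain m where m: "n = Suc m" "m \<ge> N" using n by (cases n) auto
      have "\<tau> n * (1 / (2 * d'\<^sup>2 * s) + 1) \<le> \<tau> m"
      proof -
        have "\<tau> n / \<tau> m \<le> \<kappa>" using N(2)[OF m(2)] m(1) by simp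
        moreover have "0 < 1 / (2 * d'\<^sup>2 * s) + 1" using d' s by (simp add: add_pos_pos)
        ultimately show ?thesis using tau_pos[of m] by (simp add: \<kappa>_def divide_le_eq le_divide_eq)
      qed
      then have "cmod z * (\<tau> n * (1 / (2 * d'\<^sup>2 * s) + 1)) \<le> cmod z * \<tau> m" by (rule mult_left_mono) simp
      then have "(cmod z * \<tau> n) * (1 / (2 * d'\<^sup>2 * s)) \<le> cmod z * \<tau> m - cmod z * \<tau> n"
        by (simp add: algebra_simps)
      moreover have "1 * (1 / (2 * d'\<^sup>2 * s)) \<le> (cmod z * \<tau> n) * (1 / (2 * d'\<^sup>2 * s))"
        using z2 s by (intro mult_right_mono) auto
      ultimately have "1 / (2 * d'\<^sup>2 * s) \<le> cmod z * \<tau> m - cmod z * \<tau> n" by linarith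
      then have "s * (1 / (2 * d'\<^sup>2 * s)) \<le> s * (cmod z * \<tau> m - cmod z * \<tau> n)"
        using s by (intro mult_left_mono) auto
      then have "1 / (2 * d'\<^sup>2) \<le> Im z * (\<tau> m - \<tau> (Suc m))"
        using step[of m] s m(1) by simp
      then have "cmod (wedge (Z n) (yv z 1 n)) \<le> d' * norm (yv z 1 n)"
        unfolding m(1) by (intro wedge_yv_attracted[OF Im0 d'])
      from wedge_yv_transport[OF Im0 this]
      have "cmod (wedge (Z (Suc n)) (yv z 1 (Suc n)))
        \<le> exp (3 * (cmod z * \<tau> n)) * (d' + chordal (Z n) (Z (Suc n))) * norm (yv z 1 (Suc n))" .
      also have "\<dots> \<le> (exp (3 * R) * (d' + d')) * norm (yv z 1 (Suc n))"
        using False d' chordal_nonneg[of "Z n" "Z (Suc n)"] N(3)[of n] n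
        by (intro mult_right_mono mult_mono) auto
      also have "exp (3 * R) * (d' + d') = d" by (simp add: d'_def exp_minus)
      finally show ?thesis .
    qed
    let ?v = "yv z 1 (Suc (Suc n))" and ?c = "chordal (Z (Suc n)) (Z (Suc (Suc n)))"
    have c: "?c \<le> d" "0 \<le> ?c" using N(3)[of "Suc n"] n d'd chordal_nonneg by auto
    \<comment> \<open>The next piece may still have length comparable to \<open>1 / cmod z\<close>,
      so it is crossed explicitly; only what lies below \<open>\<tau> (Suc (Suc n))\<close> is
      treated as a perturbation.\<close>
    have "cmod (wedge (Z (Suc (Suc n))) ?v) \<le> exp (3 * (cmod z * \<tau> (Suc n))) * (d + ?c) * norm ?v"
      by (rule wedge_yv_transport[OF Im0 1])
    also have "\<dots> \<le> (E * (d + d)) * norm ?v"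
      unfolding E_def using z1 c d by (intro mult_right_mono mult_mono) auto
    finally have 2: "cmod (wedge (Z (Suc (Suc n))) ?v) \<le> (E * (d + d)) * norm ?v" .
    have "cmod (wedge (Z (Suc n)) ?v) \<le> cmod (wedge (Z (Suc (Suc n))) ?v) + ?c / 2 * norm ?v"
      using wedge_triangle[of "Z (Suc n)" ?v "Z (Suc (Suc n))"] by (simp add: chordal_commute)
    also have "?c / 2 * norm ?v \<le> d * norm ?v" using c d by (intro mult_right_mono) auto
    finally have 3: "cmod (wedge (Z (Suc n)) ?v) \<le> (E * (d + d) + d) * norm ?v"
      using 2 by (simp add: distrib_right)
    let ?p = "ylim z 1"
    have "cmod z * \<tau> (Suc (Suc n)) = (cmod z * \<tau> (Suc n)) * (\<tau> (Suc (Suc n)) / \<tau> (Suc n))"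
      using tau_pos[of "Suc n"] by simp
    also have "\<dots> \<le> 1 * (\<tau> (Suc (Suc n)) / \<tau> (Suc n))"
      using z1 tau_pos[of "Suc n"] tau_pos[of "Suc (Suc n)"] by (intro mult_right_mono) auto
    finally have "exp (3 * (cmod z * \<tau> (Suc (Suc n)))) - 1 \<le> d"
      using N(1)[of "Suc n"] n by (smt (verit) exp_le_cancel_iff Suc_leD le_SucI)
    then have "(exp (3 * cmod z * \<tau> (Suc (Suc n))) - 1) * norm ?v \<le> d * norm ?v"
      by (intro mult_right_mono) (simp_all add: mult.assoc)
    then have pv: "norm (?p - ?v) \<le> d * norm ?v" using ylim_diff_le[of z 1 "Suc (Suc n)"] by linarith
    \<comment> \<open>The limit vector cannot be much shorter than \<open>?v\<close>, so the error
      may be measured relative to \<open>?p\<close>.\<close>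
    have "norm ?v \<le> norm ?p + d * norm ?v"
      using norm_triangle_ineq2[of ?v ?p] pv by (simp add: norm_minus_commute)
    moreover have "d * norm ?v \<le> 1 / 2 * norm ?v" using d by (intro mult_right_mono) auto
    ultimately have v: "norm ?v \<le> 2 * norm ?p" by linarith
    have "cmod (wedge (Z (Suc n)) ?p) \<le> cmod (wedge (Z (Suc n)) ?v) + cmod (wedge (Z (Suc n)) (?p - ?v))"
      using norm_triangle_sub[of "wedge (Z (Suc n)) ?p" "wedge (Z (Suc n)) ?v"] by (simp add: wedge_linear)
    also have "\<dots> \<le> (E * (d + d) + d) * norm ?v + d * norm ?v"
      using 3 pv cmod_wedge_le[of "Z (Suc n)" "?p - ?v"] by linarith
    also have "\<dots> = (2 * (E * d) + 2 * d) * norm ?v" by (simp add: algebra_simps)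
    also have "\<dots> \<le> (4 * (E * d)) * norm ?v"
      using E d by (intro mult_right_mono) auto
    also have "\<dots> \<le> (4 * (E * d)) * (2 * norm ?p)"
      using E d v by (intro mult_left_mono) auto
    finally have "2 * cmod (wedge (Z (Suc n)) ?p) / norm ?p \<le> 16 * (E * d)"
      using ylim_nonzero[of z] by (simp add: divide_le_eq)
    moreover have "chordal (weyl_coeff H z) (Z (Suc n)) = 2 * cmod (wedge (Z (Suc n)) ?p) / norm ?p"
      using chordal_rs_div[of "fst ?p" "snd ?p" "Z (Suc n)"] ylim_nonzero[of z]
      by (simp add: weyl_coeff_eq prod_eq_iff)
    moreover have "0 < E * d" using E d by simp
    ultimately show ?thesis using d(3) by linarith
  qed
  then show ?thesis by blast
qed

end

section \<open>Cluster sets\<close>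

text \<open>Near a lower half-plane point \<open>\<xi>\<close>, a vector over an upper point has
  small \<open>wedge\<close> and, by the sign of \<open>imform\<close>, small
  \<open>cowedge\<close>. These two forms are independent, so the whole vector would be small,
  although it has norm 1.\<close>

lemma closed_upper_closed:
  assumes near: "\<And>\<epsilon>. 0 < \<epsilon> \<Longrightarrow> \<exists>\<zeta>\<in>closed_upper. chordal \<zeta> \<xi> < \<epsilon>"
  shows "\<xi> \<in> closed_upper"
proof (cases "\<xi> = None \<or> 0 \<le> Im (hx \<xi>)")
  case True
  then show ?thesis
  proof
    assume "0 \<le> Im (hx \<xi>)"
    then show ?thesis
    proof (cases \<xi>)
      case (Some w)
      have "0 < sqrt (1 + (cmod w)\<^sup>2)" using one_plus_square_pos by simp
      with \<open>0 \<le> Im (hx \<xi>)\<close> have "0 \<le> Im w"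
        by (simp add: Some hx_def zero_le_divide_iff)
      then show ?thesis by (simp add: closed_upper_def Some)
    qed (simp add: closed_upper_def)
  qed (simp add: closed_upper_def)
next
  case False
  define a b where "a = \<bar>Im (hx \<xi>)\<bar>" and "b = hy \<xi>"
  have a: "0 < a" using False by (simp add: a_def)
  have b: "0 < b" using False one_plus_square_pos by (auto simp: b_def hy_def split: option.split)
  have eta: "eta \<xi> \<le> 0" using False hy_nonneg[of \<xi>] by (simp add: eta_def mult_nonneg_nonpos)
  \<comment> \<open>Collects the bounds for \<open>hx \<zeta>\<close> and \<open>hy \<zeta>\<close>
    obtained by solving for them from the two forms.\<close>
  define C where "C = 1 / a + (1 + 1 / a) / b"
  have C: "0 < C" using a b by (simp add: C_def add_pos_pos)
  obtain \<zeta> where \<zeta>: "\<zeta> \<in> closed_upper" "chordal \<zeta> \<xi> < 1 / C" using near[of "1 / C"] C by auto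
  define \<epsilon> where "\<epsilon> = chordal \<zeta> \<xi> / 2"
  let ?v = "(hx \<zeta>, complex_of_real (hy \<zeta>))"
  have w: "cmod (wedge \<xi> ?v) = \<epsilon>" by (simp add: \<epsilon>_def chordal_hom)
  have "imform ?v = eta \<zeta>" by (simp add: imform_def eta_def)
  then have "eta \<xi> * imform ?v \<le> 0" using eta eta_nonneg[OF \<zeta>(1)] by (simp add: mult_nonpos_nonneg)
  then have "(cmod (cowedge \<xi> ?v))\<^sup>2 \<le> (cmod (wedge \<xi> ?v))\<^sup>2"
    using cowedge_wedge_imform[of \<xi> ?v] by linarith
  then have k: "cmod (cowedge \<xi> ?v) \<le> \<epsilon>" unfolding w by (rule power2_le_imp_le) (simp add: \<epsilon>_def chordal_nonneg)
  have "cowedge \<xi> ?v - wedge \<xi> ?v = (hx \<xi> - cnj (hx \<xi>)) * complex_of_real (hy \<zeta>)"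
    by (simp add: cowedge_def wedge_def algebra_simps)
  also have "cmod \<dots> = 2 * a * hy \<zeta>"
    using hy_nonneg[of \<zeta>] by (simp add: norm_mult complex_diff_cnj a_def)
  finally have "2 * a * hy \<zeta> \<le> 2 * \<epsilon>"
    using norm_triangle_ineq4[of "cowedge \<xi> ?v" "wedge \<xi> ?v"] k w by simp
  then have y: "hy \<zeta> \<le> \<epsilon> / a" using a by (simp add: field_simps)
  have "b * cmod (hx \<zeta>) = cmod (wedge \<xi> ?v + hx \<xi> * complex_of_real (hy \<zeta>))"
    using b by (simp add: wedge_def norm_mult b_def)
  also have "\<dots> \<le> cmod (wedge \<xi> ?v) + cmod (hx \<xi> * complex_of_real (hy \<zeta>))" by (rule norm_triangle_ineq)
  also have "\<dots> \<le> \<epsilon> + 1 * (\<epsilon> / a)"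
  proof -
    have "(cmod (hx \<xi>))\<^sup>2 \<le> 1" using hx_hy_unit[of \<xi>] zero_le_power2[of "hy \<xi>"] by linarith
    then have "cmod (hx \<xi>) \<le> 1" by (simp add: abs_square_le_1)
    then have "cmod (hx \<xi>) * hy \<zeta> \<le> 1 * (\<epsilon> / a)" using y hy_nonneg[of \<zeta>] by (intro mult_mono) auto
    then show ?thesis using w hy_nonneg[of \<zeta>] by (simp add: norm_mult)
  qed
  finally have "cmod (hx \<zeta>) \<le> (\<epsilon> + \<epsilon> / a) / b" using b by (simp add: field_simps)
  then have "cmod (hx \<zeta>) + hy \<zeta> \<le> \<epsilon> * C" using y by (simp add: C_def field_simps)
  moreover have "1 \<le> cmod (hx \<zeta>) + hy \<zeta>"
  proof (rule power2_le_imp_le)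
    show "1\<^sup>2 \<le> (cmod (hx \<zeta>) + hy \<zeta>)\<^sup>2"
      using hx_hy_unit[of \<zeta>] mult_nonneg_nonneg[OF norm_ge_zero[of "hx \<zeta>"] hy_nonneg[of \<zeta>]]
      by (simp add: power2_sum mult.commute)
  qed (simp add: hy_nonneg)
  moreover have "\<epsilon> * C < 1"
  proof -
    have "chordal \<zeta> \<xi> * C < 1" using \<zeta>(2) C by (simp add: field_simps)
    moreover have "0 \<le> chordal \<zeta> \<xi> * C" using C chordal_nonneg[of \<zeta> \<xi>] by simp
    ultimately show ?thesis by (simp add: \<epsilon>_def)
  qed
  ultimately show ?thesis by linarith
qed

lemma seq_limit_pointsI:
  assumes in_upper: "\<And>n. n \<ge> 1 \<Longrightarrow> \<zeta> n \<in> closed_upper"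
    and near: "\<And>\<epsilon> N. 0 < \<epsilon> \<Longrightarrow> \<exists>n\<ge>N. chordal (\<zeta> n) \<xi> < \<epsilon>"
  shows "\<xi> \<in> seq_limit_points \<zeta>"
proof -
  have "\<xi> \<in> closed_upper"
  proof (rule closed_upper_closed)
    fix \<epsilon> :: real assume "0 < \<epsilon>"
    then show "\<exists>\<omega>\<in>closed_upper. chordal \<omega> \<xi> < \<epsilon>" using near[of \<epsilon> 1] in_upper by blast
  qed
  moreover have "\<exists>r. \<forall>k. chordal (\<zeta> (r k)) \<xi> < 1 / Suc k \<and> r k < r (Suc k)"
  proof (rule dependent_nat_choice)
    show "\<exists>n. chordal (\<zeta> n) \<xi> < 1 / Suc 0" using near[of 1 0] by auto
    show "\<exists>m. chordal (\<zeta> m) \<xi> < 1 / Suc (Suc k) \<and> n < m" for n k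
      using near[of "1 / Suc (Suc k)" "Suc n"] by (auto simp: Suc_le_eq)
  qed
  then obtain r where r: "\<And>k. chordal (\<zeta> (r k)) \<xi> < 1 / Suc k" "\<And>k. r k < r (Suc k)" by blast
  have "strict_mono r" using r(2) by (simp add: strict_mono_Suc_iff)
  moreover have "(\<lambda>k. chordal (\<zeta> (r k)) \<xi>) \<longlonglongrightarrow> 0"
    by (rule tendsto_sandwich[OF _ _ tendsto_const LIMSEQ_Suc[OF lim_1_over_n]])
       (use r(1) chordal_nonneg in \<open>auto intro!: always_eventually less_imp_le\<close>)
  ultimately show ?thesis unfolding seq_limit_points_def by blast
qed

lemma cluster_setI:
  assumes "\<And>\<epsilon> R. 0 < \<epsilon> \<Longrightarrow> \<exists>z\<in>M. R \<le> cmod z \<and> chordal (q z) \<xi> < \<epsilon>"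
  shows "\<xi> \<in> cluster_set q M"
proof -
  have "\<forall>k::nat. \<exists>z\<in>M. real k \<le> cmod z \<and> chordal (q z) \<xi> < 1 / Suc k"
    using assms by simp
  then obtain z where z: "\<And>k. z k \<in> M" "\<And>k. real k \<le> cmod (z k)" "\<And>k. chordal (q (z k)) \<xi> < 1 / Suc k"
    by metis
  have "filterlim (\<lambda>k. cmod (z k)) at_top sequentially"
    by (rule filterlim_at_top_mono[OF filterlim_real_sequentially]) (use z(2) in auto)
  moreover have "(\<lambda>k. chordal (q (z k)) \<xi>) \<longlonglongrightarrow> 0"
    by (rule tendsto_sandwich[OF _ _ tendsto_const LIMSEQ_Suc[OF lim_1_over_n]])
       (use z(3) chordal_nonneg in \<open>auto intro!: always_eventually less_imp_le\<close>)
  ultimately show ?thesis unfolding cluster_set_def using z(1) by blast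
qed

text \<open>The moduli of a connected tail of \<open>M\<close> form an interval, unbounded because
  \<open>M\<close> is.\<close>

lemma cond_star_moduli:
  assumes "cond_star M"
  obtains \<rho>0 where "\<And>\<rho>. \<rho> \<ge> \<rho>0 \<Longrightarrow> \<exists>z\<in>M. cmod z = \<rho>"
proof -
  have unb: "\<exists>z\<in>M. R \<le> cmod z" for R
  proof (rule ccontr)
    assume "\<not> ?thesis"
    then have "\<forall>z\<in>M. cmod z \<le> R" by force
    then have "bounded M" by (auto simp: bounded_iff)
    then show False using assms by (simp add: cond_star_def)
  qed
  obtain r0 where r0: "connected {z \<in> M. r0 \<le> cmod z}" using assms by (auto simp: cond_star_def)
  obtain z0 where z0: "z0 \<in> M" "r0 \<le> cmod z0" using unb by blast
  have "\<exists>z\<in>M. cmod z = \<rho>" if "\<rho> \<ge> cmod z0" for \<rho>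
  proof -
    obtain z1 where z1: "z1 \<in> M" "\<rho> \<le> cmod z1" using unb by blast
    let ?S = "cmod ` {z \<in> M. r0 \<le> cmod z}"
    have "connected ?S" using r0 by (intro connected_continuous_image continuous_intros)
    moreover have "cmod z0 \<in> ?S" using z0 by blast
    moreover have "cmod z1 \<in> ?S" using z1 z0 that by auto
    ultimately have "\<rho> \<in> ?S" using that z1(2) unfolding connected_iff_interval by blast
    then show ?thesis by auto
  qed
  then show thesis by (rule that)
qed

context step_hamiltonian
begin

lemma cluster_set_sector_subset:
  assumes "(\<lambda>n. \<tau> (Suc n) / \<tau> n) \<longlonglongrightarrow> 0" "(\<lambda>n. chordal (Z (Suc n)) (Z n)) \<longlonglongrightarrow> 0"
    and \<alpha>: "0 < \<alpha>" "\<alpha> \<le> pi / 2"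
  shows "cluster_set (weyl_coeff H) (Gamma_sector \<alpha>) \<subseteq> seq_limit_points Z"
proof
  fix \<xi> assume "\<xi> \<in> cluster_set (weyl_coeff H) (Gamma_sector \<alpha>)"
  then obtain z where z: "\<And>k. z k \<in> Gamma_sector \<alpha>" "filterlim (\<lambda>k. cmod (z k)) at_top sequentially"
    "(\<lambda>k. chordal (weyl_coeff H (z k)) \<xi>) \<longlonglongrightarrow> 0" unfolding cluster_set_def by auto
  show "\<xi> \<in> seq_limit_points Z"
  proof (rule seq_limit_pointsI)
    fix \<epsilon> :: real and N :: nat assume \<epsilon>: "0 < \<epsilon>"
    obtain N' where N': "\<And>n w. n \<ge> N' \<Longrightarrow> w \<in> Gamma_sector \<alpha> \<Longrightarrow> cmod w * \<tau> (Suc n) \<le> 1 \<Longrightarrow> 1 \<le> cmod w * \<tau> n \<Longrightarrow>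
      chordal (weyl_coeff H w) (Z (Suc n)) < \<epsilon> / 2"
      using weyl_coeff_near_Z[OF assms, of "\<epsilon> / 2"] \<epsilon> by auto
    define K where "K = max N N'"
    have "\<forall>\<^sub>F k in sequentially. 1 / \<tau> K < cmod (z k) \<and> chordal (weyl_coeff H (z k)) \<xi> < \<epsilon> / 2"
      using filterlim_at_top_dense[THEN iffD1, OF z(2), rule_format, of "1 / \<tau> K"]
        order_tendstoD(2)[OF z(3), of "\<epsilon> / 2"] \<epsilon> by (auto intro: eventually_conj)
    then obtain k where k: "1 / \<tau> K < cmod (z k)" "chordal (weyl_coeff H (z k)) \<xi> < \<epsilon> / 2"
      using eventually_happens'[OF sequentially_bot] by blast
    \<comment> \<open>The piece containing \<open>?s\<close> has index \<open>Suc n\<close>, which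
      yields the two inequalities required of \<open>n\<close>.\<close>
    let ?s = "1 / cmod (z k)"
    have zp: "0 < cmod (z k)" using k(1) tau_pos[of K] by (smt (verit) divide_pos_pos)
    then have s: "0 < ?s" by simp
    have "?s < \<tau> K" using k(1) zp tau_pos[of K] by (simp add: field_simps)
    then have "K < idx ?s"
      using tau_idx[OF s] tau_antimono[of "idx ?s" K] by (meson leD leI less_le_trans not_less_iff_gr_or_eq order.strict_trans)
    then obtain n where n: "idx ?s = Suc n" "K \<le> n" by (cases "idx ?s") auto
    have "cmod (z k) * \<tau> (Suc n) \<le> 1" using tau_idx[OF s] n(1) zp by (simp add: field_simps)
    moreover have "1 \<le> cmod (z k) * \<tau> n" using le_tau_idx[of n ?s] n(1) zp by (simp add: field_simps)
    ultimately have "chordal (weyl_coeff H (z k)) (Z (Suc n)) < \<epsilon> / 2"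
      using n(2) z(1) by (intro N') (auto simp: K_def)
    then have "chordal (Z (Suc n)) \<xi> < \<epsilon>"
      using k(2) chordal_triangle[of "Z (Suc n)" \<xi> "weyl_coeff H (z k)"] chordal_commute[of "Z (Suc n)"] by simp
    then show "\<exists>n\<ge>N. chordal (Z n) \<xi> < \<epsilon>" using n(2) by (intro exI[of _ "Suc n"]) (auto simp: K_def)
  qed (rule Z_in)
qed

lemma seq_limit_points_subset_cluster_set:
  assumes "(\<lambda>n. \<tau> (Suc n) / \<tau> n) \<longlonglongrightarrow> 0" "(\<lambda>n. chordal (Z (Suc n)) (Z n)) \<longlonglongrightarrow> 0"
    and M: "cond_star M"
  shows "seq_limit_points Z \<subseteq> cluster_set (weyl_coeff H) M"
proof
  fix \<xi> assume "\<xi> \<in> seq_limit_points Z"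
  then obtain r where r: "strict_mono r" "(\<lambda>k. chordal (Z (r k)) \<xi>) \<longlonglongrightarrow> 0"
    unfolding seq_limit_points_def by auto
  obtain \<alpha> where \<alpha>: "0 < \<alpha>" "\<alpha> \<le> pi / 2" "M \<subseteq> Gamma_sector \<alpha>" using M by (auto simp: cond_star_def)
  obtain \<rho>0 where \<rho>0: "\<And>\<rho>. \<rho> \<ge> \<rho>0 \<Longrightarrow> \<exists>z\<in>M. cmod z = \<rho>" using cond_star_moduli[OF M] by blast
  show "\<xi> \<in> cluster_set (weyl_coeff H) M"
  proof (rule cluster_setI)
    fix \<epsilon> R :: real assume \<epsilon>: "0 < \<epsilon>"
    obtain N where N: "\<And>n w. n \<ge> N \<Longrightarrow> w \<in> Gamma_sector \<alpha> \<Longrightarrow> cmod w * \<tau> (Suc n) \<le> 1 \<Longrightarrow> 1 \<le> cmod w * \<tau> n \<Longrightarrow>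
      chordal (weyl_coeff H w) (Z (Suc n)) < \<epsilon> / 2"
      using weyl_coeff_near_Z[OF assms(1,2) \<alpha>(1,2), of "\<epsilon> / 2"] \<epsilon> by auto
    define B where "B = max 1 (max \<rho>0 R)"
    have B: "B \<ge> 1" "B \<ge> \<rho>0" "B \<ge> R" by (auto simp: B_def)
    have "\<forall>\<^sub>F n in sequentially. \<tau> n < 1 / B" using B(1) by (intro order_tendstoD(2)[OF tau_lim]) simp
    then obtain N2 where N2: "\<And>n. n \<ge> N2 \<Longrightarrow> \<tau> n < 1 / B" by (auto simp: eventually_sequentially)
    obtain K where K: "\<And>k. k \<ge> K \<Longrightarrow> chordal (Z (r k)) \<xi> < \<epsilon> / 2"
      using order_tendstoD(2)[OF r(2), of "\<epsilon> / 2"] \<epsilon> by (auto simp: eventually_sequentially)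
    define k where "k = Suc (max K (max N N2))"
    have "k \<le> r k" using r(1) by (rule strict_mono_imp_increasing)
    then obtain n where n: "r k = Suc n" "N \<le> n" "N2 \<le> n" by (cases "r k") (auto simp: k_def)
    have "B \<le> 1 / \<tau> n" using N2[OF n(3)] tau_pos[of n] B(1) by (simp add: field_simps)
    \<comment> \<open>This modulus places \<open>1 / cmod z\<close> at the right end of the piece
      with value \<open>Z (Suc n) = Z (r k)\<close>.\<close>
    then obtain z where z: "z \<in> M" "cmod z = 1 / \<tau> n" using \<rho>0[of "1 / \<tau> n"] B(2) by auto
    have "cmod z * \<tau> (Suc n) \<le> 1" "1 \<le> cmod z * \<tau> n"
      using z(2) tau_pos[of n] tau_dec[of n] by simp_all
    then have "chordal (weyl_coeff H z) (Z (Suc n)) < \<epsilon> / 2" using z(1) \<alpha>(3) n(2) by (intro N) auto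
    moreover have "chordal (Z (Suc n)) \<xi> < \<epsilon> / 2" using K[of k] n(1) by (simp add: k_def)
    ultimately have "chordal (weyl_coeff H z) \<xi> < \<epsilon>"
      using chordal_triangle[of "weyl_coeff H z" \<xi> "Z (Suc n)"] by linarith
    moreover have "R \<le> cmod z" using z(2) \<open>B \<le> 1 / \<tau> n\<close> B(3) by simp
    ultimately show "\<exists>z\<in>M. R \<le> cmod z \<and> chordal (weyl_coeff H z) \<xi> < \<epsilon>" using z(1) by blast
  qed
qed

end

text \<open>A strictly increasing index sequence leaves 0 after its first term, so the value at
  index 0 may be chosen freely.\<close>

lemma seq_limit_points_fun_upd: "seq_limit_points (\<zeta>(0 := \<omega>)) = seq_limit_points \<zeta>"
proof -
  have "(\<lambda>k. chordal ((\<zeta>(0 := \<omega>)) (r k)) \<xi>) \<longlonglongrightarrow> 0 \<longleftrightarrow> (\<lambda>k. chordal (\<zeta> (r k)) \<xi>) \<longlonglongrightarrow> 0"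
    if "strict_mono r" for r \<xi>
  proof (rule tendsto_cong)
    have "r k \<noteq> 0" if "k \<ge> 1" for k
      using strict_mono_imp_increasing[OF \<open>strict_mono r\<close>, of k] that by linarith
    then show "\<forall>\<^sub>F k in sequentially. chordal ((\<zeta>(0 := \<omega>)) (r k)) \<xi> = chordal (\<zeta> (r k)) \<xi>"
      unfolding eventually_sequentially by (metis fun_upd_other)
  qed
  then show ?thesis unfolding seq_limit_points_def by blast
qed

theorem mainTheorem13:
  fixes t :: "nat \<Rightarrow> real" and \<zeta> :: "nat \<Rightarrow> rsphere" and H :: "real \<Rightarrow> real^2^2"
    and M :: "complex set"
  assumes t_pos: "\<forall>n\<ge>1. t n > 0"
    and t1: "t 1 = 1"
    and t_dec: "\<forall>n\<ge>1. t (Suc n) < t n"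
    and t_lim: "t \<longlonglongrightarrow> 0"
    and t_ratio: "(\<lambda>n. t (Suc n) / t n) \<longlonglongrightarrow> 0"
    and \<zeta>_in: "\<forall>n\<ge>1. \<zeta> n \<in> closed_upper"
    and \<zeta>_lim: "(\<lambda>n. chordal (\<zeta> (Suc n)) (\<zeta> n)) \<longlonglongrightarrow> 0"
    and H_pieces: "\<forall>n\<ge>1. \<forall>s. t (Suc n) < s \<and> s \<le> t n \<longrightarrow> H s = Theta (\<zeta> n)"
    and H_tail: "\<forall>s>1. H s = Theta (Some 0)"
    and M_star: "cond_star M"
  shows "Ca (weyl_coeff H) = cluster_set (weyl_coeff H) M \<and>
         cluster_set (weyl_coeff H) M = seq_limit_points \<zeta>"
proof -
  \<comment> \<open>The shift makes \<open>\<tau> 0 = t 1 = 1\<close>, and index 0 of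
    \<open>Z\<close> is taken by the value on (1, \<infinity>).\<close>
  define \<tau> where "\<tau> = (\<lambda>n. t (Suc n))"
  define Z where "Z = \<zeta>(0 := Some 0)"
  interpret step_hamiltonian \<tau> Z H
  proof
    show "Z n \<in> closed_upper" for n
      using \<zeta>_in by (cases n) (auto simp: Z_def closed_upper_def)
    show "\<tau> \<longlonglongrightarrow> 0" unfolding \<tau>_def using t_lim by (rule LIMSEQ_Suc)
  qed (use t_pos t1 t_dec H_pieces H_tail in \<open>auto simp: \<tau>_def Z_def\<close>)
  have ratio: "(\<lambda>n. \<tau> (Suc n) / \<tau> n) \<longlonglongrightarrow> 0" unfolding \<tau>_def using LIMSEQ_Suc[OF t_ratio] .
  have "(\<lambda>n. chordal (Z (Suc (Suc n))) (Z (Suc n))) \<longlonglongrightarrow> 0"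
    using LIMSEQ_Suc[OF \<zeta>_lim] by (simp add: Z_def)
  then have Zlim: "(\<lambda>n. chordal (Z (Suc n)) (Z n)) \<longlonglongrightarrow> 0" by (rule LIMSEQ_imp_Suc)
  have "Ca (weyl_coeff H) \<subseteq> seq_limit_points Z"
    unfolding Ca_def using cluster_set_sector_subset[OF ratio Zlim] by (fastforce simp del: le_divide_eq_numeral1)
  moreover have "seq_limit_points Z \<subseteq> cluster_set (weyl_coeff H) M"
    by (rule seq_limit_points_subset_cluster_set[OF ratio Zlim M_star])
  \<comment> \<open>This inclusion closes the cycle and holds because \<open>M\<close> lies in one
    of the sectors.\<close>
  moreover have "cluster_set (weyl_coeff H) M \<subseteq> Ca (weyl_coeff H)"
    using M_star unfolding cond_star_def Ca_def cluster_set_def by blast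
  moreover have "seq_limit_points Z = seq_limit_points \<zeta>"
    unfolding Z_def by (rule seq_limit_points_fun_upd)
  ultimately show ?thesis by blast
qed

end
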